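(* Let $R$ be a closed SMLL net (no occurrence of $\bot$ in its conclusions). Then the normal form of $R$ for $\to$ contains no cut links, no boxes, and no sync links; i.e. it is a plain MLL net.
   Context: SMLL formulas: $A ::= 1 \mid \bot \mid X \mid X^\bot \mid A\otimes A \mid A ⅋ A$ (⅋ is "par"), involutive negation with $1^\bot=\bot$, $(A\otimes B)^\bot=A^\bot ⅋ B^\bot$. Positive formulas $P ::= 1 \mid P\otimes P$; negative $N ::= \bot \mid N ⅋ N$. SMLL nets are built from axiom, cut, $\otimes$, ⅋, one (conclusion $1$) and bot (conclusion $\bot$) links, each bot link with a box of conclusions $\bot,\Gamma$ containing a net of conclusions $\Gamma$ (boxes nested or disjoint), and $n$-ary sync links whose $i$-th premiss and $i$-th conclusion share a positive or negative type (in-edges: positive premisses and negative conclusions; out-edges: positive conclusions and negative premisses). Correctness: no cyclic switching path (undirected simple path using at most one premiss of each ⅋ and at most one out-edge of each sync link) in the 0-graph (boxes replaced by single nodes, depth 0 only), and correct box contents. Reduction $\to$, at depth 0 only: axiom/cut; $\otimes$/⅋ cut replaced by two cuts; pushing a sync link above a $\otimes$ or ⅋ link; moving a sync from the positive conclusion $P$ of an axiom to its other conclusion $P^\bot$; moving a sync from premiss $P^\bot$ of a cut to the other premiss $P$; erasing a sync all of whose premisses are conclusions of one links; opening a box whose lock is cut against a one link. The reduction is strongly normalizing and confluent, so normal forms exist and are unique. *)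

theory Defs
  imports "HOL-Library.Multiset"
begin

datatype 'v form =
    One
  | Bot
  | Var 'v
  | NegVar 'v
  | Tensor "'v form" "'v form"  (infixr "\<otimes>" 65)
  | Par "'v form" "'v form"  (infixr "\<parallel>" 65)

primrec neg :: "'v form \<Rightarrow> 'v form" where
  "neg One = Bot"
| "neg Bot = One"
| "neg (Var x) = NegVar x"
| "neg (NegVar x) = Var x"
| "neg (A \<otimes> B) = neg A \<parallel> neg B"
| "neg (A \<parallel> B) = neg A \<otimes> neg B"

lemma neg_neg [simp]: "neg (neg A) = A"
  by (induction A) auto

fun positive :: "'v form \<Rightarrow> bool" where
  "positive One = True"
| "positive (A \<otimes> B) = (positive A \<and> positive B)"
| "positive _ = False"

fun negative :: "'v form \<Rightarrow> bool" where
  "negative Bot = True"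
| "negative (A \<parallel> B) = (negative A \<and> negative B)"
| "negative _ = False"

primrec bot_free :: "'v form \<Rightarrow> bool" where
  "bot_free One = True"
| "bot_free Bot = False"
| "bot_free (Var x) = True"
| "bot_free (NegVar x) = True"
| "bot_free (A \<otimes> B) = (bot_free A \<and> bot_free B)"
| "bot_free (A \<parallel> B) = (bot_free A \<and> bot_free B)"

text \<open>
  A structure is a finite multiset of links (the nodes of the graph at depth 0), wired together
  by named edges that carry their type. In the binary links the conclusion comes last.
  \<open>BotBox e \<Gamma> M\<close> is a bot link together with its box: \<open>e\<close> is the lock, \<open>M\<close> the content, and \<open>\<Gamma>\<close> the
  remaining conclusions. The edges in \<open>\<Gamma>\<close> cross the border of the box, so they bear the same
  names inside and outside. The list in \<open>Sync ps\<close> consists of the pairs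
  (\<open>i\<close>-th premiss, \<open>i\<close>-th conclusion).
\<close>

datatype 'v edge = Edge (ident: nat) (ty: "'v form")

datatype 'e link =
    is_Ax: Ax 'e 'e
  | is_Cut: Cut 'e 'e
  | is_TensorL: TensorL 'e 'e 'e
  | is_ParL: ParL 'e 'e 'e
  | is_OneL: OneL 'e
  | is_BotBox: BotBox 'e "'e multiset" "'e link multiset"
  | is_Sync: Sync "('e \<times> 'e) list"

type_synonym 'v struct = "'v edge link multiset"

primrec prems :: "'e link \<Rightarrow> 'e multiset" where
  "prems (Ax a b) = {#}"
| "prems (Cut a b) = {#a, b#}"
| "prems (TensorL a b c) = {#a, b#}"
| "prems (ParL a b c) = {#a, b#}"
| "prems (OneL a) = {#}"
| "prems (BotBox e \<Gamma> M) = {#}"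
| "prems (Sync ps) = mset (map fst ps)"

primrec concls :: "'e link \<Rightarrow> 'e multiset" where
  "concls (Ax a b) = {#a, b#}"
| "concls (Cut a b) = {#}"
| "concls (TensorL a b c) = {#c#}"
| "concls (ParL a b c) = {#c#}"
| "concls (OneL a) = {#a#}"
| "concls (BotBox e \<Gamma> M) = add_mset e \<Gamma>"
| "concls (Sync ps) = mset (map snd ps)"

definition all_prems :: "'e link multiset \<Rightarrow> 'e multiset" where
  "all_prems N = (\<Sum>l\<in>#N. prems l)"

definition all_concls :: "'e link multiset \<Rightarrow> 'e multiset" where
  "all_concls N = (\<Sum>l\<in>#N. concls l)"

definition conclusions :: "'e link multiset \<Rightarrow> 'e multiset" where
  "conclusions N = all_concls N - all_prems N"

text \<open>\<open>set_link\<close> also collects the edges inside boxes, at every depth.\<close>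

definition edges :: "'e link multiset \<Rightarrow> 'e set" where
  "edges N = (\<Union>l\<in>set_mset N. set_link l)"

primrec well_typed :: "'v edge link \<Rightarrow> bool" where
  "well_typed (Ax a b) = (ty b = neg (ty a))"
| "well_typed (Cut a b) = (ty b = neg (ty a))"
| "well_typed (TensorL a b c) = (ty c = ty a \<otimes> ty b)"
| "well_typed (ParL a b c) = (ty c = ty a \<parallel> ty b)"
| "well_typed (OneL a) = (ty a = One)"
| "well_typed (BotBox e \<Gamma> M) = (ty e = Bot)"
| "well_typed (Sync ps) =
    (\<forall>(p, c) \<in> set ps. ty p = ty c \<and> (positive (ty p) \<or> negative (ty p)))"

text \<open>
  Every edge is the conclusion of exactly one link and the premiss of at most one link; moreover
  the edges hidden in a box are used nowhere outside of it, so that opening a box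
  is a mere union.
\<close>

inductive smll_structure :: "'v struct \<Rightarrow> bool" where
  "\<lbrakk> \<forall>l \<in># N. well_typed l;
     \<forall>e. count (all_concls N) e \<le> 1;
     all_prems N \<subseteq># all_concls N;
     \<forall>e \<Gamma> M. BotBox e \<Gamma> M \<in># N \<longrightarrow>
       smll_structure M \<and> \<Gamma> = conclusions M \<and>
       (edges M - set_mset \<Gamma>) \<inter> insert e (edges (N - {#BotBox e \<Gamma> M#})) = {} \<rbrakk>
   \<Longrightarrow> smll_structure N"

text \<open>
  The nodes of the 0-graph are the depth 0 links, a \<open>BotBox\<close> counting as one node.
\<close>

definition joins :: "'e link \<Rightarrow> 'e \<Rightarrow> 'e link \<Rightarrow> bool" where
  "joins l e l' \<longleftrightarrow> e \<in># concls l \<and> e \<in># prems l' \<or> e \<in># prems l \<and> e \<in># concls l'"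

definition out_edges :: "('v edge \<times> 'v edge) list \<Rightarrow> 'v edge set" where
  "out_edges ps = {c. c \<in> snd ` set ps \<and> positive (ty c)} \<union> {p. p \<in> fst ` set ps \<and> negative (ty p)}"

definition switching :: "'v struct \<Rightarrow> 'v edge set \<Rightarrow> bool" where
  "switching N E \<longleftrightarrow>
    (\<forall>a b c. ParL a b c \<in># N \<longrightarrow> \<not> (a \<in> E \<and> b \<in> E)) \<and>
    (\<forall>ps. Sync ps \<in># N \<longrightarrow> card (out_edges ps \<inter> E) \<le> 1)"

text \<open>
  \<open>vs\<close> is the list of visited nodes, starting and ending at the same node, and \<open>es\<close> the list of
  traversed edges. Loops and pairs of parallel edges count as cycles.
\<close>

definition cyclic_switching_path ::
    "'v struct \<Rightarrow> 'v edge link list \<Rightarrow> 'v edge list \<Rightarrow> bool" where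
  "cyclic_switching_path N vs es \<longleftrightarrow>
    es \<noteq> [] \<and> length vs = Suc (length es) \<and> hd vs = last vs \<and>
    distinct (tl vs) \<and> distinct es \<and> set vs \<subseteq> set_mset N \<and>
    (\<forall>i < length es. joins (vs ! i) (es ! i) (vs ! Suc i)) \<and>
    switching N (set es)"

inductive correct :: "'v struct \<Rightarrow> bool" where
  "\<lbrakk> \<nexists>vs es. cyclic_switching_path N vs es;
     \<forall>e \<Gamma> M. BotBox e \<Gamma> M \<in># N \<longrightarrow> correct M \<rbrakk>
   \<Longrightarrow> correct N"

definition smll_net :: "'v struct \<Rightarrow> bool" where
  "smll_net N \<longleftrightarrow> smll_structure N \<and> correct N"

definition closed_net :: "'v struct \<Rightarrow> bool" where
  "closed_net N \<longleftrightarrow> (\<forall>e \<in># conclusions N. bot_free (ty e))"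

definition mll_net :: "'v struct \<Rightarrow> bool" where
  "mll_net N \<longleftrightarrow> smll_net N \<and>
    (\<forall>l \<in># N. is_Ax l \<or> is_Cut l \<or> is_TensorL l \<or> is_ParL l \<or> is_OneL l)"

text \<open>
  \<open>K\<close> is the rest of the net at depth 0; there is no congruence rule for boxes. Reduction is
  arranged so that the conclusions of the net keep their names: in \<open>ax_cut\<close> it is the edge \<open>c\<close>
  above the cut that is renamed to \<open>a\<close> (also within a box having \<open>c\<close> as a conclusion).
  New edges may be chosen arbitrarily as long as they are unused, so normal forms are unique
  only up to renaming.
\<close>

inductive red :: "'v struct \<Rightarrow> 'v struct \<Rightarrow> bool"  (infix "\<leadsto>" 50) where
  ax_cut:
  "\<lbrakk> l \<in> {Ax a b, Ax b a}; k \<in> {Cut b c, Cut c b} \<rbrakk>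
   \<Longrightarrow> {#l, k#} + K \<leadsto> image_mset (map_link (\<lambda>e. if e = c then a else e)) K"
| tensor_par:
  "k \<in> {Cut c f, Cut f c}
   \<Longrightarrow> {#TensorL a b c, ParL d e f, k#} + K \<leadsto> {#Cut a d, Cut b e#} + K"
| sync_tensor:
  "\<lbrakk> N = {#TensorL a b c, Sync (xs @ (c, d) # ys)#} + K;
     a' \<notin> edges N; b' \<notin> edges N; a' \<noteq> b'; ty a' = ty a; ty b' = ty b \<rbrakk>
   \<Longrightarrow> N \<leadsto> {#TensorL a' b' d, Sync (xs @ (a, a') # (b, b') # ys)#} + K"
| sync_par:
  "\<lbrakk> N = {#ParL a b c, Sync (xs @ (c, d) # ys)#} + K;
     a' \<notin> edges N; b' \<notin> edges N; a' \<noteq> b'; ty a' = ty a; ty b' = ty b \<rbrakk>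
   \<Longrightarrow> N \<leadsto> {#ParL a' b' d, Sync (xs @ (a, a') # (b, b') # ys)#} + K"
| sync_ax:
  "\<lbrakk> l \<in> {Ax a b, Ax b a}; positive (ty a);
     N = {#l, Sync (xs @ (a, a') # ys)#} + K;
     b' \<notin> edges N; ty b' = ty b \<rbrakk>
   \<Longrightarrow> N \<leadsto> {#Ax a' b', Sync (xs @ (b', b) # ys)#} + K"
| sync_cut:
  "\<lbrakk> k \<in> {Cut n' p, Cut p n'}; negative (ty n');
     N = {#k, Sync (xs @ (n, n') # ys)#} + K;
     p' \<notin> edges N; ty p' = ty p \<rbrakk>
   \<Longrightarrow> N \<leadsto> {#Cut n p', Sync (xs @ (p, p') # ys)#} + K"
| sync_one:
  "{#Sync ps#} + mset (map (OneL \<circ> fst) ps) + K \<leadsto> mset (map (OneL \<circ> snd) ps) + K"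
| box_one:
  "k \<in> {Cut e a, Cut a e} \<Longrightarrow> {#BotBox e \<Gamma> M, OneL a, k#} + K \<leadsto> M + K"

definition normal_form_of :: "'v struct \<Rightarrow> 'v struct \<Rightarrow> bool" where
  "normal_form_of R N \<longleftrightarrow> red\<^sup>*\<^sup>* R N \<and> (\<nexists>N'. N \<leadsto> N')"

end

theory Submission
  imports Defs
begin

text \<open>
  Correctness is rephrased on edge names: a switched link becomes a star on the edges that it
  touches, and a net is correct iff for every switching the union of these stars is a forest.
  Every reduction step then acts on forests by contracting, deleting or subdividing edges, so
  correctness is preserved, and so are the conclusions, hence closedness.

  In a closed normal net, suppose that some link is a cut, a box, a sync link, or a tensor or par
  link whose conclusion contains \<open>\<bottom>\<close>. Each such link is blocked by another one: from a lock, from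
  the in-edge of a sync link or from a conclusion containing \<open>\<bottom>\<close> one descends until a sync link
  or a cut is met, as \<open>\<bottom>\<close> does not occur in the conclusions; and normality forces the other side
  of the cut to come from the border of a box or from a positive sync conclusion. Following the
  blocking links forever in a finite net closes a switching cycle, since every sync link is entered
  by an out-edge and left by an in-edge.
\<close>

section \<open>Forests\<close>

text \<open>Argued on paths, each rule would require rerouting a list of nodes and edges, with cases
  for where the redex meets the cycle. On edge names a switched link is a hyperedge, and a star is
  one of its spanning trees, whose centre is immaterial. Each rule thus becomes a statement about a
  few edges over an untouched rest \<open>G\<close>, which \<open>forest_add\<close> and
  \<open>conn_add\<close> reduce to propositional logic about connectivity in \<open>G\<close>;
  explicit paths appear only in the equivalence of the two notions of correctness. Keeping exactly
  one out-edge of a sync link instead of at most one is harmless, because subgraphs of forests are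
  forests.

  A box counts as a full star on its lock and border. Outer correctness therefore says that the
  border edges are pairwise disconnected outside the box, which is just what is needed to glue in
  its content.

  In the final walk the steps downwards come from closedness, as \<bottom> persists in the types
  below. Normality makes the steps upwards possible, from a cut or from a positive premiss of a sync
  link.\<close>

definition conn :: "('a \<times> 'a) multiset \<Rightarrow> 'a \<Rightarrow> 'a \<Rightarrow> bool" where
  "conn M x y \<longleftrightarrow> (x, y) \<in> (set_mset M \<union> (set_mset M)\<inverse>)\<^sup>*"

text \<open>Acyclicity in the form "every edge is a bridge". Only one copy of the edge is removed,
  so a loop or a doubled edge already counts as a cycle, in accordance with
  \<open>cyclic_switching_path\<close>.\<close>

definition forest :: "('a \<times> 'a) multiset \<Rightarrow> bool" where
  "forest M \<longleftrightarrow> (\<forall>(u, v) \<in># M. \<not> conn (M - {#(u, v)#}) u v)"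

definition vertices :: "('a \<times> 'a) multiset \<Rightarrow> 'a set" where
  "vertices M = fst ` set_mset M \<union> snd ` set_mset M"

lemma vertices_simps [simp]:
  "vertices {#} = {}"
  "vertices (add_mset (u, v) M) = insert u (insert v (vertices M))"
  "vertices (M + M') = vertices M \<union> vertices M'"
  by (auto simp: vertices_def)

lemma conn_refl [simp]: "conn M x x"
  by (simp add: conn_def)

lemma conn_sym: "conn M x y \<Longrightarrow> conn M y x"
proof -
  have "sym (set_mset M \<union> (set_mset M)\<inverse>)"
    by (auto simp: sym_def)
  then show "conn M x y \<Longrightarrow> conn M y x"
    unfolding conn_def by (meson sym_rtrancl symD)
qed

lemma conn_commute: "conn M x y \<longleftrightarrow> conn M y x"
  using conn_sym by metis

lemma conn_trans: "conn M x y \<Longrightarrow> conn M y z \<Longrightarrow> conn M x z"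
  unfolding conn_def by (rule rtrancl_trans)

lemma conn_mono: "conn M x y \<Longrightarrow> set_mset M \<subseteq> set_mset M' \<Longrightarrow> conn M' x y"
  unfolding conn_def by (rule rtrancl_mono[THEN subsetD, rotated]) auto

lemma conn_edge: "(x, y) \<in># M \<Longrightarrow> conn M x y"
  unfolding conn_def by auto

lemma conn_induct [consumes 1, case_names refl step]:
  assumes "conn M x y" "P x"
    "\<And>y z. conn M x y \<Longrightarrow> (y, z) \<in># M \<or> (z, y) \<in># M \<Longrightarrow> P y \<Longrightarrow> P z"
  shows "P y"
  using assms(1) unfolding conn_def
proof (induction rule: rtrancl_induct)
  case base
  then show ?case using assms(2) .
next
  case (step y z)
  then show ?case using assms(3)[of y z] by (auto simp: conn_def)
qed

lemma conn_empty [simp]: "conn {#} x y \<longleftrightarrow> x = y"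
  by (simp add: conn_def)

text \<open>A path can be shortened until it crosses the additional edge at most once, in one of its
  two directions.\<close>

lemma conn_add:
  "conn (add_mset (u, v) M) x y \<longleftrightarrow>
    conn M x y \<or> conn M x u \<and> conn M v y \<or> conn M x v \<and> conn M u y"
  (is "?L \<longleftrightarrow> ?R")
proof
  assume ?L
  then show ?R
  proof (induction rule: conn_induct)
    case refl
    then show ?case by simp
  next
    case (step y z)
    then consider "conn M y z" | "y = u" "z = v" | "y = v" "z = u"
      using conn_edge conn_sym by (metis insert_iff prod.inject set_mset_add_mset_insert)
    then show ?case
      using step.IH by cases (auto intro: conn_trans)
  qed
next
  have *: "conn (add_mset (u, v) M) x y" if "conn M x y" for x y
    using that by (rule conn_mono) auto
  have uv: "conn (add_mset (u, v) M) u v" "conn (add_mset (u, v) M) v u"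
    using conn_edge conn_sym by (metis union_single_eq_member)+
  assume ?R
  then show ?L
    by (elim disjE conjE) (blast intro: * uv conn_trans)+
qed

lemma conn_isolated: "x \<notin> vertices M \<Longrightarrow> conn M x y \<longleftrightarrow> x = y"
proof
  show "x \<notin> vertices M \<Longrightarrow> conn M x y \<Longrightarrow> x = y"
    unfolding conn_def by (erule converse_rtranclE) (force simp: vertices_def)+
qed simp

lemma conn_vertices: "conn M x y \<Longrightarrow> x \<noteq> y \<Longrightarrow> x \<in> vertices M \<and> y \<in> vertices M"
  using conn_isolated conn_sym by metis

lemma forest_empty [simp]: "forest {#}"
  by (simp add: forest_def)

text \<open>Forests can be tested edge by edge in any order. Together with \<open>conn_add\<close>
  this settles the small modifications below by propositional reasoning.\<close>

lemma forest_add: "forest (add_mset (u, v) M) \<longleftrightarrow> forest M \<and> \<not> conn M u v"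
proof
  assume L: "forest (add_mset (u, v) M)"
  have "\<not> conn (M - {#(x, y)#}) x y" if xy: "(x, y) \<in># M" for x y
  proof
    assume "conn (M - {#(x, y)#}) x y"
    then have "conn (add_mset (u, v) M - {#(x, y)#}) x y"
      by (rule conn_mono) (use xy in \<open>auto dest: multi_member_split\<close>)
    then show False using L xy by (force simp: forest_def)
  qed
  then show "forest M \<and> \<not> conn M u v"
    using L by (force simp: forest_def)
next
  assume R: "forest M \<and> \<not> conn M u v"
  have "\<not> conn (add_mset (u, v) M - {#(x, y)#}) x y" if "(x, y) \<in># add_mset (u, v) M" for x y
  proof (cases "(x, y) = (u, v)")
    case False
    then obtain M' where M': "M = add_mset (x, y) M'"
      using \<open>(x, y) \<in># add_mset (u, v) M\<close> by (auto dest: multi_member_split)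
    then have "\<not> conn M' x y"
      using R by (force simp: forest_def)
    \<comment> \<open>A detour around (x, y) through the new edge would, closed by (x, y) itself,
      connect u and v in \<open>M\<close>.\<close>
    moreover have "\<not> (conn M' x u \<and> conn M' v y)" "\<not> (conn M' x v \<and> conn M' u y)"
      using R conn_sym[of M'] conn_refl by (auto simp: M' conn_add)
    ultimately show ?thesis
      using False by (auto simp: M' conn_add add_mset_commute[of "(u, v)"])
  qed (use R in auto)
  then show "forest (add_mset (u, v) M)"
    by (force simp: forest_def)
qed

lemma forest_mono: "forest (M + M') \<Longrightarrow> forest M"
  by (induction M') (auto simp: forest_add)

section \<open>Elementary surgery on forests\<close>

lemma forest_flip: "forest (add_mset (u, v) M) \<longleftrightarrow> forest (add_mset (v, u) M)"
  by (simp add: forest_add conn_commute)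

lemma forest_pendant:
  assumes "v \<notin> vertices M" "u \<noteq> v"
  shows "forest (add_mset (u, v) M) \<longleftrightarrow> forest M"
  using assms conn_isolated conn_commute by (metis forest_add)

lemma forest_subdivide:
  assumes "v \<notin> vertices M" "u \<noteq> v" "w \<noteq> v"
  shows "forest (add_mset (u, v) (add_mset (w, v) M)) \<longleftrightarrow> forest (add_mset (u, w) M)"
  using conn_isolated[OF assms(1)] conn_commute[of M v] assms(2,3)
  by (auto simp: forest_add conn_add)

lemma forest_contract1:
  "forest (add_mset (u, v) (add_mset (v, w) M)) \<Longrightarrow> forest (add_mset (u, w) M)"
  using conn_commute[of M] by (auto simp: forest_add conn_add)

text \<open>A tree on \<open>u\<close>, \<open>v\<close>, \<open>w\<close>, \<open>w'\<close> is
  replaced by one on \<open>u\<close>, \<open>w\<close>, \<open>w'\<close>, which connects fewer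
  vertices, so no cycle appears. This absorbs a tensor link into the sync link below it.\<close>

lemma forest_contract2:
  "forest (add_mset (u, v) (add_mset (v, w) (add_mset (v, w') M)))
    \<Longrightarrow> forest (add_mset (u, w) (add_mset (u, w') M))"
  by (auto simp: forest_add conn_add conn_commute)

text \<open>Contraction of the edge (a, c). A path in the quotient lifts to one in the graph with
  this edge, which is used to pass between the two representatives of the merged vertex.\<close>

lemma forest_identify:
  assumes "forest (add_mset (a, c) M)"
  defines "f \<equiv> \<lambda>x. if x = c then a else x"
  shows "forest (image_mset (map_prod f f) M)"
proof -
  have f: "conn (add_mset (a, c) M') x y" if "f x = f y" for x y M'
    using that by (auto simp: f_def conn_add split: if_splits)
  have lift: "conn (add_mset (a, c) M') x y"
    if "conn (image_mset (map_prod f f) M') x' y'" "x' = f x" "y' = f y" for M' x y x' y'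
    using that
  proof (induction arbitrary: y rule: conn_induct)
    case refl
    then show ?case using f by simp
  next
    case (step y' z')
    then obtain p q where pq: "(p, q) \<in># M' \<or> (q, p) \<in># M'" "y' = f p" "z' = f q"
      by auto
    then have "conn (add_mset (a, c) M') x p"
      using step by blast
    moreover have "conn (add_mset (a, c) M') p q"
      using pq(1) conn_edge conn_sym by (metis union_iff add_mset_add_single)
    moreover have "conn (add_mset (a, c) M') q y"
      using pq step.prems f by metis
    ultimately show ?case
      by (meson conn_trans)
  qed
  show ?thesis
    unfolding forest_def
  proof (clarsimp, goal_cases)
    case (1 x y)
    then obtain M' where M': "M = add_mset (x, y) M'"
      by (auto dest: multi_member_split)
    then have "conn (add_mset (a, c) M') x y"
      using lift 1 by auto
    then show False
      using assms(1) by (auto simp: M' forest_add add_mset_commute[of "(a, c)"])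
  qed
qed

text \<open>The gluing principle for opening a box: \<open>H\<close> comes from the content,
  \<open>G\<close> from outside, and \<open>W\<close> contains the edges of the content. The
  induction also carries that \<open>G\<close> creates no new connection between vertices of
  \<open>W\<close>.\<close>

lemma forest_glue:
  assumes "forest G" "forest H" "vertices H \<subseteq> W" "\<forall>x\<in>W. \<forall>y\<in>W. conn G x y \<longrightarrow> x = y"
  shows "forest (H + G)"
proof -
  have "forest (H + G) \<and> (\<forall>x\<in>W. \<forall>y\<in>W. conn (H + G) x y \<longrightarrow> conn H x y)"
    using assms(2,3)
  proof (induction H)
    case empty
    then show ?case using assms(1,4) by auto
  next
    case (add p H)
    obtain u v where [simp]: "p = (u, v)" by fastforce
    show ?case
      using add by (auto simp: forest_add conn_add)
  qed
  then show ?thesis ..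
qed

section \<open>Stars as hyperedges\<close>

abbreviation star :: "'a \<Rightarrow> 'a multiset \<Rightarrow> ('a \<times> 'a) multiset" where
  "star r X \<equiv> image_mset (Pair r) X"

lemma vertices_star: "vertices (star r X) \<subseteq> insert r (set_mset X)"
  by (auto simp: vertices_def)

text \<open>Both stars are spanning trees of the same vertices, so they connect the same
  things.\<close>

lemma forest_recenter:
  "forest (star r (add_mset s X) + M) \<longleftrightarrow> forest (star s (add_mset r X) + M)"
proof -
  \<comment> \<open>The edge (r, s) is kept in the common part, so that the leaves can be moved
    across it one at a time.\<close>
  have "forest (star r X + add_mset (r, s) M) \<longleftrightarrow> forest (star s X + add_mset (r, s) M)" for M
  proof (induction X arbitrary: M)
    case (add x X)
    have "forest (star r (add_mset x X) + add_mset (r, s) M)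
        \<longleftrightarrow> forest (star r X + add_mset (r, s) (add_mset (r, x) M))"
      by simp
    also have "\<dots> \<longleftrightarrow> forest (star s X + add_mset (r, s) (add_mset (r, x) M))"
      using add.IH by blast
    also have "\<dots> \<longleftrightarrow> forest (add_mset (r, x) (add_mset (r, s) (star s X + M)))"
      by (simp add: add_mset_commute)
    also have "\<dots> \<longleftrightarrow> forest (add_mset (s, x) (add_mset (r, s) (star s X + M)))"
      by (auto simp: forest_add conn_add conn_commute)
    also have "\<dots> \<longleftrightarrow> forest (star s (add_mset x X) + add_mset (r, s) M)"
      by (simp add: add_mset_commute)
    finally show ?case by blast
  qed simp
  then have "forest (add_mset (r, s) (star r X + M)) \<longleftrightarrow> forest (add_mset (r, s) (star s X + M))"
    by simp
  then show ?thesis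
    using forest_flip[of r s "star s X + M"] by simp
qed

lemma conn_star: "x \<in># add_mset r X \<Longrightarrow> y \<in># add_mset r X \<Longrightarrow> conn (star r X) x y"
proof -
  have "conn (star r X) r z" if "z \<in># add_mset r X" for z
    using that by (auto simp: conn_edge)
  then show "x \<in># add_mset r X \<Longrightarrow> y \<in># add_mset r X \<Longrightarrow> conn (star r X) x y"
    by (blast intro: conn_trans conn_sym)
qed

lemma pair_subset_add:
  "{#x, y#} \<subseteq># add_mset s Z \<longleftrightarrow>
    {#x, y#} \<subseteq># Z \<or> x = s \<and> y \<in># Z \<or> y = s \<and> x \<in># Z"
proof -
  have mem: "x \<in># Z \<and> y \<in># Z" if "{#x, y#} \<subseteq># Z" for Z
    using mset_subset_eqD[OF that] by simp
  consider "x = s" | "y = s" | "x \<noteq> s" "y \<noteq> s" by blast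
  then show ?thesis
  proof cases
    case 1
    have "{#x, y#} \<subseteq># add_mset s Z \<longleftrightarrow> {#y#} \<subseteq># Z"
      unfolding 1 by (rule mset_subset_eq_add_mset_cancel)
    then show ?thesis using mem[of Z] 1 by auto
  next
    case 2
    have "{#x, y#} \<subseteq># add_mset s Z \<longleftrightarrow> {#x#} \<subseteq># Z"
      unfolding 2 add_mset_commute[of x s] by simp
    then show ?thesis using mem[of Z] 2 by auto
  next
    case 3
    then have "{#x, y#} \<subseteq># add_mset s Z \<longleftrightarrow> {#x, y#} \<subseteq># Z"
      by (simp add: insert_subset_eq_iff diff_add_mset_swap)
    then show ?thesis using 3 by blast
  qed
qed

text \<open>The hyperedge view of a star, symmetric in centre and leaves. Pairs are taken as
  submultisets: a vertex occurring twice yields x = y, which is always connected and hence rules out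
  a forest.\<close>

lemma forest_star_iff:
  "forest (star r X + M) \<longleftrightarrow>
    forest M \<and> (\<forall>x y. {#x, y#} \<subseteq># add_mset r X \<longrightarrow> \<not> conn M x y)"
proof (induction X arbitrary: M)
  case empty
  have "\<not> {#x, y#} \<subseteq># {#r#}" for x y
    by (auto dest!: size_mset_mono)
  then show ?case by simp
next
  case (add s X)
  have mem: "x \<in># Z \<and> y \<in># Z" if "{#x, y#} \<subseteq># Z" for x y :: 'a and Z
    using that by (auto dest: mset_subset_eqD)
  have split: "{#x, y#} \<subseteq># add_mset r (add_mset s X) \<longleftrightarrow>
      {#x, y#} \<subseteq># add_mset r X \<or> x = s \<and> y \<in># add_mset r X \<or> y = s \<and> x \<in># add_mset r X" for x y
    by (subst add_mset_commute) (rule pair_subset_add)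
  have rX: "{#r, x#} \<subseteq># add_mset r X" if "x \<in># X" for x
    using that by simp
  have "forest (star r (add_mset s X) + M) \<longleftrightarrow> forest (star r X + add_mset (r, s) M)"
    by simp
  also have "\<dots> \<longleftrightarrow> forest M \<and> \<not> conn M r s \<and>
      (\<forall>x y. {#x, y#} \<subseteq># add_mset r X \<longrightarrow> \<not> conn (add_mset (r, s) M) x y)"
    unfolding add.IH forest_add by blast
  also have "\<dots> \<longleftrightarrow> forest M \<and> (\<forall>x y. {#x, y#} \<subseteq># add_mset r (add_mset s X) \<longrightarrow> \<not> conn M x y)"
    (is "?L \<longleftrightarrow> ?R")
  proof
    assume L: ?L
    have "\<not> conn M s y" if "y \<in># add_mset r X" for y
    proof (cases "y = r")
      case True
      then show ?thesis using L conn_sym by metis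
    next
      case False
      then show ?thesis using L rX[of y] that by (metis conn_add conn_refl insert_iff set_mset_add_mset_insert)
    qed
    then have s: "\<not> conn M s y" "\<not> conn M y s" if "y \<in># add_mset r X" for y
      using that conn_sym[of M y s] by blast+
    have L': "\<not> conn M x y" if "{#x, y#} \<subseteq># add_mset r X" for x y
      using that L unfolding conn_add by blast
    show ?R
    proof (intro conjI allI impI)
      show "\<not> conn M x y" if "{#x, y#} \<subseteq># add_mset r (add_mset s X)" for x y
        using that[unfolded split] s L' by blast
    qed (use L in blast)
  next
    assume R: ?R
    then have s: "\<not> conn M s y" "\<not> conn M y s" if "y \<in># add_mset r X" for y
      using that unfolding split by blast+
    show ?L
      unfolding conn_add
    proof (intro conjI allI impI)
      show "\<not> conn M r s" using s by simp
      show "\<not> (conn M x y \<or> conn M x r \<and> conn M s y \<or> conn M x s \<and> conn M r y)"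
        if "{#x, y#} \<subseteq># add_mset r X" for x y
      proof -
        have "\<not> conn M x y"
          using R that unfolding split by blast
        then show ?thesis
          using s mem[OF that] by blast
      qed
    qed (use R in blast)
  qed
  finally show ?case .
qed

section \<open>Switchings\<close>

text \<open>Testing the premiss suffices: in a well-typed sync link both members of the pair share a
  type that is positive or negative, so the else branch is the negative case.\<close>

definition in_edge :: "'v edge \<times> 'v edge \<Rightarrow> 'v edge" where
  "in_edge pc = (if positive (ty (fst pc)) then fst pc else snd pc)"

definition out_edge :: "'v edge \<times> 'v edge \<Rightarrow> 'v edge" where
  "out_edge pc = (if positive (ty (fst pc)) then snd pc else fst pc)"

text \<open>
  A switched link is a star on the edges it keeps. In a sync link all in-edges and exactly one
  out-edge are kept.
\<close>

primrec switched :: "'v edge link \<Rightarrow> ('v edge \<times> 'v edge) multiset set" where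
  "switched (Ax a b) = {{#(a, b)#}}"
| "switched (Cut a b) = {{#(a, b)#}}"
| "switched (TensorL a b c) = {{#(c, a), (c, b)#}}"
| "switched (ParL a b c) = {{#(c, a)#}, {#(c, b)#}}"
| "switched (OneL a) = {{#}}"
| "switched (BotBox e \<Gamma> M) = {star e \<Gamma>}"
| "switched (Sync ps) = (if ps = [] then {{#}} else
     {star r (mset (map in_edge ps)) | r. r \<in> out_edge ` set ps})"

text \<open>\<open>Z\<close> attaches a choice to each occurrence of a link, so the definition
  recurses over the multiset of links without assuming that links are distinct.\<close>

definition net_switched :: "'v struct \<Rightarrow> ('v edge \<times> 'v edge) multiset \<Rightarrow> bool" where
  "net_switched N H \<longleftrightarrow>
    (\<exists>Z. image_mset fst Z = N \<and> (\<forall>z \<in># Z. snd z \<in> switched (fst z)) \<and> H = (\<Sum>z\<in>#Z. snd z))"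

definition acyc :: "'v struct \<Rightarrow> bool" where
  "acyc N \<longleftrightarrow> (\<forall>H. net_switched N H \<longrightarrow> forest H)"

abbreviation ends :: "'e link \<Rightarrow> 'e multiset" where
  "ends l \<equiv> prems l + concls l"

lemma net_switched_empty [simp]: "net_switched {#} H \<longleftrightarrow> H = {#}"
  by (simp add: net_switched_def)

lemma net_switched_add:
  "net_switched (add_mset l N) H \<longleftrightarrow> (\<exists>h\<in>switched l. \<exists>H'. net_switched N H' \<and> H = h + H')"
proof
  assume "net_switched (add_mset l N) H"
  then obtain Z where Z: "image_mset fst Z = add_mset l N" "\<forall>z \<in># Z. snd z \<in> switched (fst z)"
    "H = (\<Sum>z\<in>#Z. snd z)"
    unfolding net_switched_def by blast
  from msed_map_invR[OF Z(1)] obtain Z' z where "Z = add_mset z Z'" "fst z = l" "image_mset fst Z' = N"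
    by blast
  then show "\<exists>h\<in>switched l. \<exists>H'. net_switched N H' \<and> H = h + H'"
    using Z unfolding net_switched_def by auto
next
  assume "\<exists>h\<in>switched l. \<exists>H'. net_switched N H' \<and> H = h + H'"
  then obtain h Z where "h \<in> switched l" "image_mset fst Z = N" "\<forall>z \<in># Z. snd z \<in> switched (fst z)"
    "H = h + (\<Sum>z\<in>#Z. snd z)"
    unfolding net_switched_def by blast
  then show "net_switched (add_mset l N) H"
    unfolding net_switched_def by (intro exI[of _ "add_mset (l, h) Z"]) auto
qed

lemma net_switched_union:
  "net_switched (M + N) H \<longleftrightarrow> (\<exists>H1 H2. net_switched M H1 \<and> net_switched N H2 \<and> H = H1 + H2)"
proof (induction M arbitrary: H)
  case (add l M)
  have "net_switched (add_mset l M + N) H \<longleftrightarrow>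
      (\<exists>h\<in>switched l. \<exists>H1 H2. net_switched M H1 \<and> net_switched N H2 \<and> H = h + H1 + H2)"
    by (simp add: net_switched_add add.IH add.assoc) blast
  then show ?case
    unfolding net_switched_add by blast
qed simp

lemma in_edge_ends: "z \<in> set ps \<Longrightarrow> in_edge z \<in># ends (Sync ps)"
  by (auto simp: in_edge_def)

lemma out_edge_ends: "z \<in> set ps \<Longrightarrow> out_edge z \<in># ends (Sync ps)"
  by (auto simp: out_edge_def)

lemma sync_ends: "ends (Sync ps) = mset (map in_edge ps) + mset (map out_edge ps)"
  by (induction ps) (auto simp: in_edge_def out_edge_def)

text \<open>The inclusion is one of multisets: an edge met twice by a star is attached to the link
  twice, which later identifies self-loops.\<close>

lemma switched_star:
  assumes "h \<in> switched l" "h \<noteq> {#}"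
  obtains r X where "h = star r X" "add_mset r X \<subseteq># ends l"
proof (cases l)
  case (Ax a b)
  then show ?thesis using assms that[of a "{#b#}"] by simp
next
  case (Cut a b)
  then show ?thesis using assms that[of a "{#b#}"] by simp
next
  case (TensorL a b c)
  then show ?thesis using assms that[of c "{#a, b#}"] by simp
next
  case (ParL a b c)
  then show ?thesis using assms that[of c "{#a#}"] that[of c "{#b#}"] by auto
next
  case (Sync ps)
  then obtain z where z: "z \<in> set ps" "h = star (out_edge z) (mset (map in_edge ps))"
    using assms by (auto split: if_splits)
  then have "{#out_edge z#} \<subseteq># mset (map out_edge ps)"
    by simp
  then have "add_mset (out_edge z) (mset (map in_edge ps)) \<subseteq># ends l"
    unfolding Sync sync_ends by (metis add.commute add_mset_add_single subset_mset.add_left_mono)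
  then show ?thesis using z that by blast
qed (use assms that in auto)

lemma switched_vertices: "h \<in> switched l \<Longrightarrow> vertices h \<subseteq> set_mset (ends l)"
proof (cases "h = {#}")
  case False
  assume "h \<in> switched l"
  then obtain r X where "h = star r X" "add_mset r X \<subseteq># ends l"
    using switched_star False by blast
  then show ?thesis
    using vertices_star[of r X] set_mset_mono[of "add_mset r X" "ends l"] by force
qed simp

lemma all_prems_simps [simp]:
  "all_prems {#} = {#}" "all_prems (add_mset l N) = prems l + all_prems N"
  "all_prems (M + N) = all_prems M + all_prems N"
  by (simp_all add: all_prems_def)

lemma all_concls_simps [simp]:
  "all_concls {#} = {#}" "all_concls (add_mset l N) = concls l + all_concls N"
  "all_concls (M + N) = all_concls M + all_concls N"
  by (simp_all add: all_concls_def)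

lemma net_switched_vertices:
  "net_switched N H \<Longrightarrow> vertices H \<subseteq> set_mset (all_prems N + all_concls N)"
proof (induction N arbitrary: H)
  case (add l N)
  then obtain h H' where "h \<in> switched l" "net_switched N H'" "H = h + H'"
    by (auto simp: net_switched_add)
  then show ?case
    using switched_vertices[of h l] add.IH[of H'] by auto
qed simp

section \<open>Linearity: one producer and at most one consumer per edge\<close>

definition linear :: "'e link multiset \<Rightarrow> bool" where
  "linear N \<longleftrightarrow> (\<forall>e. count (all_concls N) e \<le> 1) \<and> all_prems N \<subseteq># all_concls N"

lemma linear_prems: "linear N \<Longrightarrow> count (all_prems N) e \<le> 1"
  unfolding linear_def by (meson le_trans mset_subset_eq_count)

lemma linear_concls: "linear N \<Longrightarrow> count (all_concls N) e \<le> 1"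
  unfolding linear_def by blast

lemma mem_all_prems: "l \<in># N \<Longrightarrow> e \<in># prems l \<Longrightarrow> e \<in># all_prems N"
  by (auto simp: all_prems_def)

lemma mem_all_concls: "l \<in># N \<Longrightarrow> e \<in># concls l \<Longrightarrow> e \<in># all_concls N"
  by (auto simp: all_concls_def)

lemma all_prems_obtain:
  assumes "e \<in># all_prems N" obtains l where "l \<in># N" "e \<in># prems l"
  using assms by (auto simp: all_prems_def)

lemma all_concls_obtain:
  assumes "e \<in># all_concls N" obtains l where "l \<in># N" "e \<in># concls l"
  using assms by (auto simp: all_concls_def)

lemma concls_unique:
  assumes "linear N" "l \<in># N" "l' \<in># N" "e \<in># concls l" "e \<in># concls l'"
  shows "l = l'"
proof (rule ccontr)
  assume "l \<noteq> l'"
  then obtain K where "N = add_mset l (add_mset l' K)"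
    using assms by (metis insert_noteq_member mset_add)
  then have "count (all_concls N) e \<ge> count (concls l) e + count (concls l') e" by simp
  moreover have "count (concls l) e \<ge> 1" "count (concls l') e \<ge> 1"
    using assms by simp_all
  ultimately show False
    using linear_concls[OF assms(1), of e] by linarith
qed

lemma prems_unique:
  assumes "linear N" "l \<in># N" "l' \<in># N" "e \<in># prems l" "e \<in># prems l'"
  shows "l = l'"
proof (rule ccontr)
  assume "l \<noteq> l'"
  then obtain K where "N = add_mset l (add_mset l' K)"
    using assms by (metis insert_noteq_member mset_add)
  then have "count (all_prems N) e \<ge> count (prems l) e + count (prems l') e" by simp
  moreover have "count (prems l) e \<ge> 1" "count (prems l') e \<ge> 1"
    using assms by simp_all
  ultimately show False
    using linear_prems[OF assms(1), of e] by linarith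
qed

lemma count_concls: "linear N \<Longrightarrow> l \<in># N \<Longrightarrow> count (concls l) e \<le> 1"
  using linear_concls[of N e] by (auto dest!: multi_member_split)

lemma count_prems: "linear N \<Longrightarrow> l \<in># N \<Longrightarrow> count (prems l) e \<le> 1"
  using linear_prems[of N e] by (auto dest!: multi_member_split)

text \<open>Every edge of a repeated link would be counted twice, so such a link has no edges and
  can only be \<open>Sync []\<close>.\<close>

lemma linear_duplicate:
  assumes "linear N" "add_mset l (add_mset l K) \<subseteq># N"
  shows "switched l = {{#}}"
proof -
  obtain K' where N: "N = add_mset l (add_mset l K) + K'"
    using assms(2) by (auto simp: mset_subset_eq_exists_conv)
  have "count (concls l) e = 0" "count (prems l) e = 0" for e
    using linear_concls[OF assms(1), of e] linear_prems[OF assms(1), of e] by (auto simp: N)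
  then have "concls l = {#}" "prems l = {#}"
    by (auto intro: multiset_eqI)
  then show ?thesis
    by (cases l) auto
qed

text \<open>A choice per occurrence becomes a function on links. Conflicts could arise only at
  repeated links, where by \<open>linear_duplicate\<close> there is nothing to choose.\<close>

lemma net_switched_choice:
  assumes "linear N" "net_switched N H"
  obtains \<sigma> where "\<forall>l\<in>#N. \<sigma> l \<in> switched l" "H = (\<Sum>l\<in>#N. \<sigma> l)"
proof -
  have "\<exists>\<sigma>. (\<forall>l\<in>#M. \<sigma> l \<in> switched l) \<and> H = (\<Sum>l\<in>#M. \<sigma> l)"
    if "M \<subseteq># N" "net_switched M H" for M H
    using that
  proof (induction M arbitrary: H)
    case (add l M)
    then obtain h H' where H: "h \<in> switched l" "net_switched M H'" "H = h + H'"
      by (auto simp: net_switched_add)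
    from add.IH[OF _ this(2)] add.prems(1)
    obtain \<sigma> where \<sigma>: "\<forall>l\<in>#M. \<sigma> l \<in> switched l" "H' = (\<Sum>l\<in>#M. \<sigma> l)"
      by (meson mset_subset_eq_insertD subset_mset.less_imp_le)
    show ?case
    proof (cases "l \<in># M")
      case True
      then obtain K where "M = add_mset l K"
        by (auto dest: multi_member_split)
      then have "switched l = {{#}}"
        using linear_duplicate[OF assms(1)] add.prems(1) by blast
      then show ?thesis
        using True H \<sigma> by (intro exI[of _ \<sigma>]) auto
    next
      case False
      then have "(\<Sum>k\<in>#M. (\<sigma>(l := h)) k) = H'"
        unfolding \<sigma>(2) by (intro arg_cong[where f = sum_mset] image_mset_cong) auto
      then show ?thesis
        using False H \<sigma> by (intro exI[of _ "\<sigma>(l := h)"]) auto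
    qed
  qed auto
  then show ?thesis
    using assms(2) that by blast
qed

lemma choice_net_switched: "\<forall>l\<in>#N. \<sigma> l \<in> switched l \<Longrightarrow> net_switched N (\<Sum>l\<in>#N. \<sigma> l)"
  by (induction N) (auto simp: net_switched_add)

text \<open>A walk in the incidence structure of links and vertices: each pair records the link that
  is crossed and the vertex that is reached.\<close>

fun chain :: "('l \<Rightarrow> 'a set) \<Rightarrow> 'a \<Rightarrow> ('l \<times> 'a) list \<Rightarrow> bool" where
  "chain S x [] \<longleftrightarrow> True"
| "chain S x ((l, y) # zs) \<longleftrightarrow> x \<in> S l \<and> y \<in> S l \<and> chain S y zs"

lemma chain_append: "chain S x (zs @ (l, y) # zs') \<longleftrightarrow>
    chain S x zs \<and> last (x # map snd zs) \<in> S l \<and> y \<in> S l \<and> chain S y zs'"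
  by (induction zs arbitrary: x) auto

lemma chain_nth:
  "chain S x zs \<Longrightarrow> i < length zs \<Longrightarrow>
    (x # map snd zs) ! i \<in> S (fst (zs ! i)) \<and> snd (zs ! i) \<in> S (fst (zs ! i))"
proof (induction zs arbitrary: x i)
  case (Cons z zs)
  then show ?case
    by (cases z; cases i) force+
qed simp

lemma chain_snd: "chain S x zs \<Longrightarrow> z \<in> set zs \<Longrightarrow> snd z \<in> S (fst z)"
  by (induction zs arbitrary: x) auto

text \<open>
  Extending a chain at its front: skip to the last vertex that lies on the new link.
\<close>

lemma conn_chain:
  assumes "conn (\<Sum>l\<in>#M. \<sigma> l) x y"
  obtains zs where "chain (\<lambda>l. vertices (\<sigma> l)) x zs" "last (x # map snd zs) = y"
    "distinct (x # map snd zs)" "distinct (map fst zs)" "fst ` set zs \<subseteq> set_mset M"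
proof -
  let ?P = "\<lambda>x zs. chain (\<lambda>l. vertices (\<sigma> l)) x zs \<and> last (x # map snd zs) = y \<and>
    distinct (x # map snd zs) \<and> distinct (map fst zs) \<and> fst ` set zs \<subseteq> set_mset M"
  \<comment> \<open>The induction starts from \<open>y\<close>, so that the chain grows at its
    front.\<close>
  have "conn (\<Sum>l\<in>#M. \<sigma> l) y x"
    using assms by (rule conn_sym)
  then have "\<exists>zs. ?P x zs"
  proof (induction rule: conn_induct)
    case refl
    then show ?case by (intro exI[of _ "[]"]) simp
  next
    case (step w z)
    then obtain zs where zs: "?P w zs" by blast
    obtain l where l: "l \<in># M" "w \<in> vertices (\<sigma> l)" "z \<in> vertices (\<sigma> l)"
      using step(2) by (force simp: vertices_def)
    show ?case
    \<comment> \<open>If \<open>z\<close> has been visited, the part of the chain behind it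
      suffices. This keeps the vertices distinct, while the skip in the other case keeps the links
      distinct: no link behind the skip contains a vertex reached through \<open>l\<close>.\<close>
    proof (cases "z \<in> insert w (snd ` set zs)")
      case True
      show ?thesis
      proof (cases "z = w")
        case False
        then obtain k where "(k, z) \<in> set zs"
          using True by auto
        then obtain us vs where "zs = us @ (k, z) # vs"
          by (auto dest: split_list)
        then show ?thesis
          using zs by (intro exI[of _ vs]) (simp add: chain_append image_Un)
      qed (use zs in blast)
    next
      case z: False
      show ?thesis
      proof (cases "\<exists>p\<in>set zs. snd p \<in> vertices (\<sigma> l)")
        case True
        then obtain us p vs where s: "zs = us @ p # vs" "snd p \<in> vertices (\<sigma> l)"
          "\<forall>q\<in>set vs. snd q \<notin> vertices (\<sigma> l)"
          using split_list_last_prop[OF True] by blast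
        obtain k v where [simp]: "p = (k, v)" by fastforce
        have ch: "chain (\<lambda>l. vertices (\<sigma> l)) v vs"
          using zs s by (auto simp: chain_append)
        then have "l \<notin> fst ` set vs"
          using chain_snd[OF ch] s(3) by force
        moreover have "last (v # map snd vs) = y" "distinct (map snd (p # vs))"
          "distinct (map fst vs)" "fst ` set vs \<subseteq> set_mset M" "z \<notin> snd ` set (p # vs)"
          using zs z unfolding s(1) by (simp_all add: image_Un)
        ultimately have "?P z ((l, v) # vs)"
          using s(2) l ch by (intro conjI) simp_all
        then show ?thesis by (rule exI[where x = "(l, v) # vs"])
      next
        case False
        then have "l \<notin> fst ` set zs"
          using chain_snd[of "\<lambda>l. vertices (\<sigma> l)" w zs] zs by force
        moreover have "chain (\<lambda>l. vertices (\<sigma> l)) w zs" "last (w # map snd zs) = y"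
          "distinct (w # map snd zs)" "distinct (map fst zs)" "fst ` set zs \<subseteq> set_mset M"
          using zs by blast+
        ultimately have "?P z ((l, w) # zs)"
          using l z by (intro conjI) simp_all
        then show ?thesis by (rule exI[where x = "(l, w) # zs"])
      qed
    qed
  qed
  then show ?thesis
    using that by blast
qed

section \<open>From cycles of stars to cyclic switching paths\<close>

lemma vertices_star_eq: "X \<noteq> {#} \<Longrightarrow> vertices (star r X) = insert r (set_mset X)"
  by (cases X) (auto simp: vertices_def image_image)

text \<open>An edge is a premiss at most once and a conclusion at most once. Two distinct links
  touching it use up both roles.\<close>

lemma shared_edge:
  assumes "linear N" "l \<in># N" "l' \<in># N" "l \<noteq> l'" "e \<in># ends l" "e \<in># ends l'"
  shows "joins l e l'"
    and "k \<in># N \<Longrightarrow> e \<in># ends k \<Longrightarrow> k = l \<or> k = l'"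
    and "k \<in># N \<Longrightarrow> \<not> (e \<in># prems k \<and> e \<in># concls k)"
  using concls_unique[OF assms(1)] prems_unique[OF assms(1)] assms unfolding joins_def
  by (metis union_iff)+

lemma out_edges_eq:
  "well_typed (Sync ps) \<Longrightarrow> out_edges ps = out_edge ` set ps"
proof -
  have pn: "\<not> (positive A \<and> negative A)" for A :: "'v form"
    by (cases A) auto
  assume "well_typed (Sync ps)"
  then have *: "ty p = ty c \<and> (positive (ty p) \<or> negative (ty p))" if "(p, c) \<in> set ps" for p c
    using that by auto
  show ?thesis
  proof (intro equalityI subsetI)
    fix x assume "x \<in> out_edges ps"
    then consider p where "(p, x) \<in> set ps" "positive (ty x)" | c where "(x, c) \<in> set ps" "negative (ty x)"
      unfolding out_edges_def by fastforce
    then show "x \<in> out_edge ` set ps"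
    proof cases
      case (1 p)
      then show ?thesis using *[of p x] by (intro image_eqI[of _ _ "(p, x)"]) (auto simp: out_edge_def)
    next
      case (2 c)
      then show ?thesis using pn by (intro image_eqI[of _ _ "(x, c)"]) (auto simp: out_edge_def)
    qed
  next
    fix x assume "x \<in> out_edge ` set ps"
    then obtain p c where "(p, c) \<in> set ps" "x = out_edge (p, c)" by auto
    then show "x \<in> out_edges ps"
      using *[of p c] unfolding out_edges_def out_edge_def by (force split: if_splits)
  qed
qed

text \<open>Both pairs have the sign of the type of \<open>x\<close>. With equal signs an in-edge
  and an out-edge lie on opposite sides of the link.\<close>

lemma in_out_edge_loop:
  assumes "well_typed (Sync ps)" "x \<in> in_edge ` set ps" "x \<in> out_edge ` set ps"
  shows "x \<in># prems (Sync ps) \<and> x \<in># concls (Sync ps)"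
proof -
  obtain p c p' c' where "(p, c) \<in> set ps" "(p', c') \<in> set ps"
    "x = in_edge (p, c)" "x = out_edge (p', c')"
    using assms(2,3) by auto
  moreover have "ty p = ty c" "ty p' = ty c'"
    using assms(1) calculation by auto
  ultimately show ?thesis
    by (force simp: in_edge_def out_edge_def split: if_splits)
qed

text \<open>When the links are added one at a time, \<open>l\<close> is the one whose star closes a
  cycle, so the rest of this cycle runs through \<open>M'\<close> only.\<close>

lemma first_cycle:
  assumes "\<not> forest (\<Sum>l\<in>#M. \<sigma> l)"
  obtains l M' where "add_mset l M' \<subseteq># M" "forest (\<Sum>l\<in>#M'. \<sigma> l)"
    "\<not> forest (\<sigma> l + (\<Sum>l\<in>#M'. \<sigma> l))"
proof -
  have "\<exists>l M'. add_mset l M' \<subseteq># M \<and> forest (\<Sum>l\<in>#M'. \<sigma> l) \<and> \<not> forest (\<sigma> l + (\<Sum>l\<in>#M'. \<sigma> l))"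
    using assms
  proof (induction M)
    case (add k M)
    show ?case
    proof (cases "forest (\<Sum>l\<in>#M. \<sigma> l)")
      case True
      then show ?thesis using add.prems by (intro exI[of _ k] exI[of _ M]) auto
    next
      case False
      then obtain l M' where "add_mset l M' \<subseteq># M" "forest (\<Sum>l\<in>#M'. \<sigma> l)"
        "\<not> forest (\<sigma> l + (\<Sum>l\<in>#M'. \<sigma> l))"
        using add.IH by blast
      moreover have "M \<subseteq># add_mset k M"
        by (metis add_mset_add_single mset_subset_eq_add_left)
      ultimately show ?thesis by (meson subset_mset.order_trans)
    qed
  qed simp
  then show ?thesis using that by blast
qed

lemma loop_path:
  assumes lin: "linear N" and "l \<in># N" "x \<in># prems l" "x \<in># concls l"
  shows "cyclic_switching_path N [l, l] [x]"
proof -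
  have "\<not> (ParL x x c \<in># N)" for c
    using count_prems[OF lin, of "ParL x x c" x] by auto
  moreover have "card (out_edges ps \<inter> {x}) \<le> 1" for ps
    using card_mono[of "{x}" "out_edges ps \<inter> {x}"] by simp
  ultimately show ?thesis
    using assms unfolding cyclic_switching_path_def switching_def
    by (auto simp: joins_def)
qed

text \<open>The star of the link closing a cycle meets two connected vertices \<open>x\<close> and
  \<open>y\<close>. A chain between them, with this link put at both ends, is the cyclic switching
  path.\<close>

lemma acyc_if_no_path:
  assumes lin: "linear N" and wt: "\<forall>l\<in>#N. well_typed l"
    and no_path: "\<nexists>vs es. cyclic_switching_path N vs es"
  shows "acyc N"
  unfolding acyc_def
proof (intro allI impI, rule ccontr)
  fix H assume "net_switched N H" and nf: "\<not> forest H"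
  then obtain \<sigma> where \<sigma>: "\<forall>l\<in>#N. \<sigma> l \<in> switched l" and H: "H = (\<Sum>l\<in>#N. \<sigma> l)"
    using net_switched_choice[OF lin] by blast
  from first_cycle[OF nf[unfolded H]]
  obtain l M where lM: "add_mset l M \<subseteq># N" "forest (\<Sum>l\<in>#M. \<sigma> l)"
    "\<not> forest (\<sigma> l + (\<Sum>l\<in>#M. \<sigma> l))"
    by blast
  have lN: "l \<in># N" and MN: "set_mset M \<subseteq> set_mset N"
    using lM(1) by (auto dest: mset_subset_eqD)
  \<comment> \<open>A second copy of \<open>l\<close> would make its star empty, and then it could
    not close a cycle.\<close>
  have lM': "l \<notin># M"
  proof
    assume "l \<in># M"
    then obtain K where "M = add_mset l K" by (auto dest: multi_member_split)
    then have "\<sigma> l = {#}"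
      using linear_duplicate[OF lin] lM(1) \<sigma> lN by fastforce
    then show False using lM by simp
  qed
  have "\<sigma> l \<noteq> {#}"
    using lM by auto
  then obtain r X where rX: "\<sigma> l = star r X" "add_mset r X \<subseteq># ends l"
    using switched_star \<sigma> lN by blast
  obtain x y where xy: "{#x, y#} \<subseteq># add_mset r X" "conn (\<Sum>l\<in>#M. \<sigma> l) x y"
    using lM(2,3) unfolding rX forest_star_iff by blast
  obtain zs where zs: "chain (\<lambda>l. vertices (\<sigma> l)) x zs" "last (x # map snd zs) = y"
    "distinct (x # map snd zs)" "distinct (map fst zs)" "fst ` set zs \<subseteq> set_mset M"
    using conn_chain[OF xy(2)] by blast
  define vs where "vs = l # map fst zs @ [l]"
  define es where "es = x # map snd zs"
  have vsN: "set vs \<subseteq> set_mset N"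
    using zs(5) MN lN unfolding vs_def by auto
  have "cyclic_switching_path N vs es"
  \<comment> \<open>Without a link in between, \<open>x\<close> equals \<open>y\<close> and the star
    of \<open>l\<close> meets this edge twice, so the path is a loop at \<open>l\<close>.\<close>
  proof (cases "zs = []")
    case True
    then have "{#x, x#} \<subseteq># ends l"
      using xy(1) rX(2) zs(2) by auto
    then have "count (ends l) x \<ge> 2"
      using mset_subset_eq_count[of "{#x, x#}" "ends l" x] by simp
    then have "x \<in># prems l" "x \<in># concls l"
      using count_prems[OF lin lN, of x] count_concls[OF lin lN, of x]
      by (auto simp flip: count_greater_zero_iff)
    then show ?thesis
      using loop_path[OF lin lN, of x] True by (simp add: vs_def es_def)
  next
    case False
    have x0: "x \<in># add_mset r X" "y \<in># add_mset r X"
      using xy(1) by (auto dest: mset_subset_eqD)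
    have "X \<noteq> {#}"
      using xy(1) by (auto dest: size_mset_mono)
    then have rXv: "z \<in> vertices (\<sigma> l)" if "z \<in># add_mset r X" for z
      using that by (simp add: rX vertices_star_eq)
    have sub: "vertices (\<sigma> k) \<subseteq> set_mset (ends k)" if "k \<in># N" for k
      using that \<sigma> switched_vertices by blast
    have len: "length vs = Suc (length es)" "length es = Suc (length zs)"
      by (simp_all add: vs_def es_def)
    have v: "es ! i \<in> vertices (\<sigma> (vs ! i))" "es ! i \<in> vertices (\<sigma> (vs ! Suc i))"
      "vs ! i \<noteq> vs ! Suc i" "vs ! i \<in># N" "vs ! Suc i \<in># N"
      if i: "i < length es" for i
    proof -
      show "vs ! i \<in># N" "vs ! Suc i \<in># N"
        using vsN len i by (metis less_SucI nth_mem subsetD Suc_less_eq)+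
      show "es ! i \<in> vertices (\<sigma> (vs ! i))"
      proof (cases i)
        case 0
        then show ?thesis using rXv x0 by (simp add: vs_def es_def)
      next
        case (Suc j)
        then show ?thesis using chain_nth[OF zs(1), of j] i by (simp add: vs_def es_def nth_append)
      qed
      show "es ! i \<in> vertices (\<sigma> (vs ! Suc i))"
      proof (cases "i < length zs")
        case True
        then show ?thesis using chain_nth[OF zs(1), of i] by (simp add: vs_def es_def nth_append)
      next
        case False
        then have "i = length zs" using i len by simp
        moreover have "es \<noteq> []" by (simp add: es_def)
        ultimately have "es ! i = y" "vs ! Suc i = l"
          using zs(2) last_conv_nth[of es] len by (simp_all add: vs_def nth_append flip: es_def)
        then show ?thesis using rXv x0 by simp
      qed
      have d: "distinct (tl vs)"
        using zs(4,5) lM' by (auto simp: vs_def)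
      have t: "vs ! Suc k = tl vs ! k" if "k < length es" for k
        using that len by (simp add: nth_tl)
      show "vs ! i \<noteq> vs ! Suc i"
      proof (cases i)
        case 0
        have "fst (zs ! 0) \<in># M"
          using zs(5) \<open>zs \<noteq> []\<close> by (auto simp: image_subset_iff)
        then show ?thesis
          using 0 \<open>zs \<noteq> []\<close> lM' by (auto simp: vs_def nth_append)
      next
        case (Suc k)
        then show ?thesis
          using t[of k] t[of i] i nth_eq_iff_index_eq[OF d, of k i] len by simp
      qed
    qed
    \<comment> \<open>Each traversed edge already joins two visited nodes, so any link touching it
      is one of these and has it in its star. What a switching discards is thus never
      traversed.\<close>
    have inc: "e \<in> vertices (\<sigma> k)" "\<not> (e \<in># prems k \<and> e \<in># concls k)"
      if "e \<in> set es" "k \<in># N" "e \<in># ends k" for e k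
    proof -
      obtain i where i: "i < length es" "e = es ! i"
        using \<open>e \<in> set es\<close> by (auto simp: in_set_conv_nth)
      note sh = shared_edge[OF lin v(4)[OF i(1)] v(5)[OF i(1)] v(3)[OF i(1)], of e]
      have "e \<in># ends (vs ! i)" "e \<in># ends (vs ! Suc i)"
        using v[OF i(1)] sub i(2) by blast+
      then show "e \<in> vertices (\<sigma> k)" "\<not> (e \<in># prems k \<and> e \<in># concls k)"
        using sh(2,3)[OF _ _ that(2)] that(3) v[OF i(1)] i(2) by auto
    qed
    have "\<not> (a \<in> set es \<and> b \<in> set es)" if "ParL a b c \<in># N" for a b c
    proof
      assume ab: "a \<in> set es \<and> b \<in> set es"
      have "a \<noteq> b"
        using count_prems[OF lin that, of a] by auto
      moreover have "a \<in> vertices (\<sigma> (ParL a b c))" "b \<in> vertices (\<sigma> (ParL a b c))" "a \<noteq> c" "b \<noteq> c"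
        using inc[of a, OF _ that] inc[of b, OF _ that] ab by auto
      ultimately show False
        using \<sigma> that by fastforce
    qed
    moreover have "card (out_edges ps \<inter> set es) \<le> 1" if ps: "Sync ps \<in># N" for ps
    proof (cases "ps = []")
      case False
      then obtain z where z: "z \<in> set ps" "\<sigma> (Sync ps) = star (out_edge z) (mset (map in_edge ps))"
        using \<sigma> ps by fastforce
      \<comment> \<open>A traversed out-edge lies in the star and is not an in-edge, since it would
        then be a loop; so it is the centre.\<close>
      have "out_edges ps \<inter> set es \<subseteq> {out_edge z}"
      proof
        fix e assume e: "e \<in> out_edges ps \<inter> set es"
        then have o: "e \<in> out_edge ` set ps"
          using out_edges_eq wt ps by blast
        then have "e \<in># ends (Sync ps)"
          using out_edge_ends by blast
        then have "e \<in> vertices (\<sigma> (Sync ps))" "\<not> (e \<in># prems (Sync ps) \<and> e \<in># concls (Sync ps))"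
          using inc ps e by blast+
        moreover from this have "e \<notin> in_edge ` set ps"
          using in_out_edge_loop o wt ps by blast
        ultimately show "e \<in> {out_edge z}"
          using z vertices_star[of "out_edge z" "mset (map in_edge ps)"] by auto
      qed
      then show ?thesis
        using card_mono[of "{out_edge z}"] by fastforce
    qed (simp add: out_edges_def)
    ultimately have "switching N (set es)"
      unfolding switching_def by blast
    moreover have "joins (vs ! i) (es ! i) (vs ! Suc i)" if "i < length es" for i
      using shared_edge(1)[OF lin] v[OF that] sub by blast
    moreover have "distinct (tl vs)" "hd vs = last vs" "distinct es"
      using zs lM' by (auto simp: vs_def es_def)
    ultimately show ?thesis
      unfolding cyclic_switching_path_def using len vsN by auto
  qed
  then show False using no_path by blast
qed


section \<open>From cyclic switching paths to cycles of stars\<close>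

lemma switching_choice:
  assumes lin: "linear N" and wt: "\<forall>l\<in>#N. well_typed l" and sw: "switching N E" and l: "l \<in># N"
  shows "\<exists>r X. star r X \<in> switched l \<and> E \<inter> set_mset (ends l) \<subseteq> set_mset (add_mset r X)"
proof (cases l)
  case (Ax a b)
  then show ?thesis by (intro exI[of _ a] exI[of _ "{#b#}"]) auto
next
  case (Cut a b)
  then show ?thesis by (intro exI[of _ a] exI[of _ "{#b#}"]) auto
next
  case (TensorL a b c)
  then show ?thesis by (intro exI[of _ c] exI[of _ "{#a, b#}"]) auto
next
  case (ParL a b c)
  then have "\<not> (a \<in> E \<and> b \<in> E)"
    using sw l by (auto simp: switching_def)
  then show ?thesis
    using ParL
    by (cases "a \<in> E") (intro exI[of _ c] exI[of _ "{#a#}"], auto, intro exI[of _ c] exI[of _ "{#b#}"], auto)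
next
  case (OneL a)
  then show ?thesis by (intro exI[of _ a] exI[of _ "{#}"]) auto
next
  case (BotBox e \<Gamma> M)
  then show ?thesis by (intro exI[of _ e] exI[of _ \<Gamma>]) auto
next
  case (Sync ps)
  show ?thesis
  proof (cases "ps = []")
    case True
    then show ?thesis using Sync by (auto intro!: exI[of _ "{#}"])
  next
    case False
    have out: "out_edges ps = out_edge ` set ps"
      using out_edges_eq wt l Sync by blast
    have card: "card (out_edge ` set ps \<inter> E) \<le> 1"
      using sw l Sync out by (auto simp: switching_def)
    obtain r where r: "r \<in> out_edge ` set ps" "out_edge ` set ps \<inter> E \<subseteq> {r}"
    proof (cases "out_edge ` set ps \<inter> E = {}")
      case True
      \<comment> \<open>If the path uses no out-edge, any of them may be kept.\<close>
      then show ?thesis using False that[of "out_edge (hd ps)"] by auto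
    next
      case False
      then obtain r where "r \<in> out_edge ` set ps \<inter> E" by blast
      then show ?thesis
        using card that[of r] by (auto simp: card_le_Suc0_iff_eq)
    qed
    then have "E \<inter> set_mset (ends l) \<subseteq> set_mset (add_mset r (mset (map in_edge ps)))"
      unfolding Sync sync_ends by auto
    moreover have "star r (mset (map in_edge ps)) \<in> switched l"
      using r(1) False Sync by auto
    ultimately show ?thesis by blast
  qed
qed

lemma forest_loop: "forest M \<Longrightarrow> (x, x) \<notin># M"
  by (auto simp: forest_add dest!: multi_member_split)

text \<open>The stars of the intermediate nodes connect consecutive traversed edges. The first and
  the last edge are therefore connected without the initial node, whose star contains both, against
  \<open>forest_star_iff\<close>.\<close>

lemma no_path_if_acyc:
  assumes lin: "linear N" and wt: "\<forall>l\<in>#N. well_typed l" and acyc: "acyc N"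
  shows "\<not> cyclic_switching_path N vs es"
proof
  assume path: "cyclic_switching_path N vs es"
  define n where "n = length es"
  have "vs \<noteq> []" "es \<noteq> []"
    using path unfolding cyclic_switching_path_def by auto
  then have n: "n > 0" "length vs = Suc n" "vs ! 0 = vs ! n" "set vs \<subseteq> set_mset N"
    and dv: "distinct (tl vs)" and de: "distinct es"
    and j: "\<And>i. i < n \<Longrightarrow> joins (vs ! i) (es ! i) (vs ! Suc i)"
    and sw: "switching N (set es)"
    using path unfolding cyclic_switching_path_def n_def
    by (auto simp: hd_conv_nth last_conv_nth)
  have vN: "vs ! i \<in># N" if "i \<le> n" for i
    using n that by (metis le_imp_less_Suc nth_mem subsetD)
  have inc: "es ! i \<in># ends (vs ! i)" "es ! i \<in># ends (vs ! Suc i)" if "i < n" for i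
    using j[OF that] by (auto simp: joins_def)
  obtain \<rho> \<chi> where choice:
    "\<forall>l\<in>#N. star (\<rho> l) (\<chi> l) \<in> switched l \<and>
      set es \<inter> set_mset (ends l) \<subseteq> set_mset (add_mset (\<rho> l) (\<chi> l))"
    using switching_choice[OF lin wt sw] by metis
  have mem: "es ! k \<in># add_mset (\<rho> (vs ! i)) (\<chi> (vs ! i))"
    if "i \<le> n" "k < n" "es ! k \<in># ends (vs ! i)" for i k
  proof -
    have "es ! k \<in> set es \<inter> set_mset (ends (vs ! i))"
      using that n_def by simp
    then show ?thesis
      using choice vN[OF that(1)] by blast
  qed
  show False
  \<comment> \<open>For n = 1 the first and the last edge coincide and yield no two occurrences in a
    star; here a switching with the loop (e, e) has to be exhibited.\<close>
  proof (cases "n = 1")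
    case True
    define l where "l = vs ! 0"
    define e where "e = es ! 0"
    have e: "e \<in># prems l" "e \<in># concls l"
      using j[of 0] n(3) True by (auto simp: joins_def l_def e_def)
    have l: "l \<in># N" "well_typed l"
      using vN[of 0] wt l_def by auto
    \<comment> \<open>Tensor and par links have a conclusion larger than their premisses; the other
      kinds lack premisses or conclusions.\<close>
    have "is_Sync l"
      using e l(2) by (cases l) auto
    then obtain ps where ps: "l = Sync ps"
      unfolding is_Sync_def by blast
    obtain c p where cp: "(e, c) \<in> set ps" "(p, e) \<in> set ps"
      using e by (auto simp: ps)
    then have "ty p = ty e"
      using l(2) unfolding ps by fastforce
    then have "e = in_edge (if positive (ty e) then (e, c) else (p, e))"
      "e = out_edge (if positive (ty e) then (p, e) else (e, c))"
      by (simp_all add: in_edge_def out_edge_def)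
    then obtain z z' where z: "z \<in> set ps" "z' \<in> set ps" "e = in_edge z" "e = out_edge z'"
      using cp by metis
    have "e \<in> out_edge ` set ps" "ps \<noteq> []"
      unfolding z(4) using z(2) by auto
    then have s: "star e (mset (map in_edge ps)) \<in> switched l"
      unfolding ps by auto
    have s': "(e, e) \<in># star e (mset (map in_edge ps))"
      using z by auto
    obtain K where K: "N = add_mset l K"
      using l by (auto dest: multi_member_split)
    have "net_switched K (\<Sum>l\<in>#K. star (\<rho> l) (\<chi> l))"
      by (rule choice_net_switched) (use choice K in simp)
    then have "net_switched N (star e (mset (map in_edge ps)) + (\<Sum>l\<in>#K. star (\<rho> l) (\<chi> l)))"
      unfolding K net_switched_add using s by blast
    then have "forest (star e (mset (map in_edge ps)) + (\<Sum>l\<in>#K. star (\<rho> l) (\<chi> l)))"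
      using acyc unfolding acyc_def by blast
    from forest_loop[OF this, of e] show False
      using s' by simp
  next
    case False
    obtain K where K: "N = add_mset (vs ! 0) K"
      using vN[of 0] by (auto dest: multi_member_split)
    let ?H = "\<Sum>l\<in>#K. star (\<rho> l) (\<chi> l)"
    have "net_switched N (\<Sum>l\<in>#N. star (\<rho> l) (\<chi> l))"
      by (rule choice_net_switched) (use choice in blast)
    then have "net_switched N (star (\<rho> (vs ! 0)) (\<chi> (vs ! 0)) + ?H)"
      by (simp add: K)
    then have forest: "forest (star (\<rho> (vs ! 0)) (\<chi> (vs ! 0)) + ?H)"
      using acyc unfolding acyc_def by blast
    have step: "conn ?H (es ! i) (es ! Suc i)" if i: "Suc i < n" for i
    proof -
      \<comment> \<open>Intermediate nodes differ from the initial one, so their stars belong to the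
        rest \<open>K\<close>.\<close>
      have "vs ! Suc i \<noteq> vs ! n"
        using dv i n(1,2) nth_eq_iff_index_eq[OF dv, of i "n - 1"] by (simp add: nth_tl)
      then have "vs ! Suc i \<in># K"
        using vN[of "Suc i"] i n(3) K by auto
      then have sub: "set_mset (star (\<rho> (vs ! Suc i)) (\<chi> (vs ! Suc i))) \<subseteq> set_mset ?H"
        by (force dest: multi_member_split)
      have "es ! i \<in># add_mset (\<rho> (vs ! Suc i)) (\<chi> (vs ! Suc i))"
        "es ! Suc i \<in># add_mset (\<rho> (vs ! Suc i)) (\<chi> (vs ! Suc i))"
        using mem[OF _ _ inc(2)[of i]] mem[OF _ _ inc(1)[of "Suc i"]] i by simp_all
      from conn_mono[OF conn_star[OF this] sub] show ?thesis .
    qed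
    have "conn ?H (es ! 0) (es ! i)" if "i < n" for i
      using that
    proof (induction i)
      case (Suc i)
      then show ?case using step[of i] conn_trans by fastforce
    qed simp
    then have c: "conn ?H (es ! 0) (es ! (n - 1))"
      using n by simp
    have "es ! 0 \<noteq> es ! (n - 1)"
      using nth_eq_iff_index_eq[OF de, of 0 "n - 1"] False n(1) unfolding n_def by linarith
    moreover have "es ! 0 \<in># add_mset (\<rho> (vs ! 0)) (\<chi> (vs ! 0))"
      using mem[OF _ _ inc(1)[of 0]] n(1) by simp
    moreover have "es ! (n - 1) \<in># add_mset (\<rho> (vs ! 0)) (\<chi> (vs ! 0))"
      using mem[OF _ _ inc(2)[of "n - 1"]] n(1,3) by simp
    ultimately have "{#es ! 0, es ! (n - 1)#} \<subseteq># add_mset (\<rho> (vs ! 0)) (\<chi> (vs ! 0))"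
      by (auto simp: insert_subset_eq_iff in_diff_count)
    then show False
      using forest c unfolding forest_star_iff by blast
  qed
qed

section \<open>Structures\<close>

lemma smll_structure_iff:
  "smll_structure N \<longleftrightarrow> (\<forall>l\<in>#N. well_typed l) \<and> linear N \<and>
    (\<forall>e \<Gamma> M. BotBox e \<Gamma> M \<in># N \<longrightarrow> smll_structure M \<and> \<Gamma> = conclusions M \<and>
      (edges M - set_mset \<Gamma>) \<inter> insert e (edges (N - {#BotBox e \<Gamma> M#})) = {})"
  by (subst smll_structure.simps) (auto simp: linear_def)

lemma correct_iff:
  "correct N \<longleftrightarrow> (\<nexists>vs es. cyclic_switching_path N vs es) \<and>
    (\<forall>e \<Gamma> M. BotBox e \<Gamma> M \<in># N \<longrightarrow> correct M)"
  by (subst correct.simps) auto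

text \<open>Only depth 0 is rephrased. Reduction leaves box contents alone apart from renaming, so
  for these \<open>correct\<close> is carried over as it stands.\<close>

lemma smll_net_iff:
  "smll_net N \<longleftrightarrow> smll_structure N \<and> acyc N \<and>
    (\<forall>e \<Gamma> M. BotBox e \<Gamma> M \<in># N \<longrightarrow> correct M)"
proof -
  have "(\<nexists>vs es. cyclic_switching_path N vs es) \<longleftrightarrow> acyc N" if "smll_structure N"
  proof -
    have "linear N" "\<forall>l\<in>#N. well_typed l"
      using that unfolding smll_structure_iff[of N] by blast+
    then show ?thesis
      using acyc_if_no_path[of N] no_path_if_acyc[of N] by blast
  qed
  then show ?thesis
    unfolding smll_net_def correct_iff[of N] by blast
qed

lemma edges_simps [simp]:
  "edges {#} = {}" "edges (add_mset l N) = set_link l \<union> edges N"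
  "edges (M + N) = edges M \<union> edges N"
  by (auto simp: edges_def)

lemma ends_set_link: "set_mset (ends l) \<subseteq> set_link l"
  by (cases l) (force simp: fsts.simps snds.simps)+

lemma set_link_ends: "\<not> is_BotBox l \<Longrightarrow> set_link l = set_mset (ends l)"
proof (cases l)
  case (Sync ps)
  then show ?thesis by (force simp: fsts.simps snds.simps)
qed auto

lemma mset_edges: "set_mset (all_prems N + all_concls N) \<subseteq> edges N"
proof (induction N)
  case (add l N)
  then show ?case using ends_set_link[of l] by auto
qed simp

lemma edges_mset:
  "\<forall>l\<in>#N. \<not> is_BotBox l \<Longrightarrow> edges N = set_mset (all_prems N + all_concls N)"
  by (induction N) (auto simp: set_link_ends)

lemma net_switched_edges: "net_switched N H \<Longrightarrow> vertices H \<subseteq> edges N"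
  by (rule subset_trans[OF net_switched_vertices mset_edges])

lemma conclusions_cancel:
  "all_concls N = X + D \<Longrightarrow> all_prems N = Y + D \<Longrightarrow> conclusions N = X - Y"
  by (simp add: conclusions_def)

text \<open>
  All rules except \<open>ax_cut\<close> and \<open>box_one\<close> have this shape: \<open>D\<close> are the internal edges they remove
  and \<open>F\<close> the fresh internal edges they introduce.
\<close>

lemma local_rewrite:
  fixes A A' K :: "'v struct"
  assumes net: "smll_net (A + K)"
    and wt: "\<And>l. l \<in># A' \<Longrightarrow> well_typed l"
    and no_box: "\<forall>l\<in>#A. \<not> is_BotBox l" "\<forall>l\<in>#A'. \<not> is_BotBox l"
    and old: "all_concls A = X + D" "all_prems A = Y + D"
    and new: "all_concls A' = X + F" "all_prems A' = Y + F"
    and fresh: "\<forall>e\<in>#F. e \<notin> edges (A + K)" "\<forall>e. count F e \<le> 1"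
    and acyc: "\<And>H' G. net_switched A' H' \<Longrightarrow> vertices G \<subseteq> edges (A + K) \<Longrightarrow>
      (\<And>H. net_switched A H \<Longrightarrow> forest (H + G)) \<Longrightarrow> forest (H' + G)"
  shows "smll_net (A' + K) \<and> conclusions (A' + K) = conclusions (A + K)"
proof -
  have st: "smll_structure (A + K)" and ac: "acyc (A + K)"
    and co: "\<And>e \<Gamma> M. BotBox e \<Gamma> M \<in># A + K \<Longrightarrow> correct M"
    using net unfolding smll_net_iff by blast+
  have lin: "linear (A + K)"
    using st smll_structure_iff by blast
  \<comment> \<open>The new links touch only old edges of \<open>A\<close> and fresh edges, so the
    edges hidden in the boxes of \<open>K\<close> stay private.\<close>
  have edgesA: "edges A' \<subseteq> edges A \<union> set_mset F"
    using no_box by (auto simp: edges_mset old new)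
  have "linear (A' + K)"
    unfolding linear_def
  proof (intro conjI allI)
    fix e
    show "count (all_concls (A' + K)) e \<le> 1"
    proof (cases "e \<in># F")
      case True
      then have "e \<notin># all_concls (A + K)"
        using fresh(1) mset_edges by fastforce
      then show ?thesis
        using fresh(2) by (simp add: new old not_in_iff)
    next
      case False
      then show ?thesis
        using linear_concls[OF lin, of e] by (simp add: new old not_in_iff)
    qed
    have "Y + all_prems K \<subseteq># X + all_concls K"
      using lin unfolding linear_def by (simp add: old ac_simps)
    then show "all_prems (A' + K) \<subseteq># all_concls (A' + K)"
      by (simp add: new ac_simps)
  qed
  moreover have "\<forall>l\<in>#A' + K. well_typed l"
    using wt st by (auto simp: smll_structure_iff[of "A + K"])
  moreover have "smll_structure M \<and> \<Gamma> = conclusions M \<and>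
      (edges M - set_mset \<Gamma>) \<inter> insert e (edges (A' + K - {#BotBox e \<Gamma> M#})) = {} \<and> correct M"
    if "BotBox e \<Gamma> M \<in># A' + K" for e \<Gamma> M
  proof -
    have B: "BotBox e \<Gamma> M \<in># K"
      using that no_box(2) by force
    then obtain K' where K: "K = add_mset (BotBox e \<Gamma> M) K'"
      by (auto dest: multi_member_split)
    have *: "smll_structure M" "\<Gamma> = conclusions M"
      "(edges M - set_mset \<Gamma>) \<inter> insert e (edges (A + K - {#BotBox e \<Gamma> M#})) = {}"
      using st B unfolding smll_structure_iff[of "A + K"] by (meson union_iff)+
    have "edges M \<subseteq> edges (A + K)"
      by (auto simp: K edges_def)
    then have "edges M \<inter> set_mset F = {}"
      using fresh(1) by blast
    then show ?thesis
      using * co[of e \<Gamma> M] edgesA B by (auto simp: K)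
  qed
  moreover have "acyc (A' + K)"
    unfolding acyc_def
  proof (intro allI impI)
    fix H assume "net_switched (A' + K) H"
    then obtain H' G where H: "net_switched A' H'" "net_switched K G" "H = H' + G"
      by (auto simp: net_switched_union)
    moreover have "vertices G \<subseteq> edges (A + K)"
      using net_switched_edges[OF H(2)] by auto
    moreover have "forest (H'' + G)" if "net_switched A H''" for H''
      using ac that H(2) unfolding acyc_def net_switched_union by blast
    ultimately show "forest H"
      using acyc by blast
  qed
  moreover have "conclusions (A' + K) = conclusions (A + K)"
    using conclusions_cancel[of "A + K" "X + all_concls K" D "Y + all_prems K"]
      conclusions_cancel[of "A' + K" "X + all_concls K" F "Y + all_prems K"]
    by (simp add: old new ac_simps)
  ultimately show ?thesis
    unfolding smll_net_iff smll_structure_iff[of "A' + K"] by blast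
qed

section \<open>Local rules\<close>

text \<open>Attach the fresh \<open>q\<close> to \<open>d\<close> as a leaf and recentre the star
  from \<open>d\<close> to \<open>q\<close>. A new out-edge thus takes over from the former
  one.\<close>

lemma forest_fresh_center:
  assumes "forest (star d Y + G)" "q \<notin> insert d (set_mset Y \<union> vertices G)"
  shows "forest (add_mset (d, q) (star q Y + G))"
proof -
  have "q \<notin> vertices (star d Y + G)"
    using assms(2) vertices_star[of d Y] by auto
  then have "forest (star d (add_mset q Y) + G)"
    using assms forest_pendant[of q "star d Y + G" d] by auto
  then show ?thesis
    using forest_recenter[of d q Y G] forest_flip[of d q] by simp
qed

text \<open>Serves both the axiom and the cut rule: \<open>a\<close>, \<open>a'\<close> are the
  in-edge and the out-edge of the pair before the move, \<open>b\<close>, \<open>b'\<close> those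
  after it. The internal edge \<open>a\<close> is contracted; the fresh \<open>b'\<close> is a leaf
  at \<open>a'\<close> or, if it is the kept out-edge, the new centre.\<close>

lemma forest_move_sync:
  assumes hyp: "\<And>r. r \<in> insert a' O' \<Longrightarrow> forest (add_mset (a, b) (star r (add_mset a I) + G))"
    and fresh: "b' \<notin> insert a' (insert b (O' \<union> set_mset I \<union> vertices G))"
    and r: "r \<in> insert b' O'"
  shows "forest (add_mset (a', b') (star r (add_mset b I) + G))"
proof -
  have *: "forest (star r (add_mset b I) + G)" if "r \<in> insert a' O'" for r
    using hyp[OF that] forest_contract1[of r a b "star r I + G"] by (simp add: add_mset_commute)
  show ?thesis
  proof (cases "r = b'")
    case True
    then show ?thesis
      using forest_fresh_center[OF *[of a'], of b'] fresh by auto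
  next
    case False
    then show ?thesis
      using r * fresh vertices_star[of r "add_mset b I"]
      by (subst forest_pendant) auto
  qed
qed

text \<open>Contracting the in-edge \<open>c\<close> leaves \<open>a\<close> and \<open>b\<close> as
  in-edges. The fresh out-edges hang at \<open>d\<close>: a chosen one becomes the centre by
  \<open>forest_fresh_center\<close>, and the rest are leaves.\<close>

lemma forest_split_tensor:
  assumes hyp: "\<And>r. r \<in> insert d O' \<Longrightarrow>
      forest (add_mset (c, a) (add_mset (c, b) (star r (add_mset c I) + G)))"
    and fresh: "a' \<noteq> b'" "{a', b'} \<inter> insert a (insert b (insert d (O' \<union> set_mset I \<union> vertices G))) = {}"
    and r: "r \<in> insert a' (insert b' O')"
  shows "forest (add_mset (d, a') (add_mset (d, b') (star r (add_mset a (add_mset b I)) + G)))"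
proof -
  have *: "forest (star r (add_mset a (add_mset b I)) + G)" if "r \<in> insert d O'" for r
    using hyp[OF that] forest_contract2[of r c a b "star r I + G"] by (simp add: add_mset_commute)
  let ?S = "\<lambda>r. star r (add_mset a (add_mset b I)) + G"
  have V: "vertices (?S r) \<subseteq> insert r (insert a (insert b (set_mset I \<union> vertices G)))" for r
    using vertices_star[of r "add_mset a (add_mset b I)"] by auto
  consider "r = a'" | "r = b'" | "r \<in> O'" using r by blast
  then show ?thesis
  proof cases
    case 1
    have "forest (add_mset (d, a') (?S a'))"
      using forest_fresh_center[OF *[of d], of a'] fresh by auto
    then have "forest (add_mset (d, b') (add_mset (d, a') (?S a')))"
      using V[of a'] fresh by (subst forest_pendant) auto
    then show ?thesis
      unfolding 1 by (simp add: add_mset_commute)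
  next
    case 2
    have "forest (add_mset (d, b') (?S b'))"
      using forest_fresh_center[OF *[of d], of b'] fresh by auto
    then show ?thesis
      unfolding 2 using V[of b'] fresh by (subst forest_pendant) auto
  next
    case 3
    have "forest (add_mset (d, b') (?S r))"
      using * 3 V[of r] fresh by (subst forest_pendant) auto
    then show ?thesis
      using 3 V[of r] fresh by (subst forest_pendant) auto
  qed
qed

text \<open>Types are negative, so the roles are reversed: before the step \<open>c\<close> is the
  out-edge and \<open>d\<close> the in-edge, afterwards \<open>a\<close>, \<open>b\<close> are
  out-edges and the fresh \<open>a'\<close>, \<open>b'\<close> in-edges, one of which is joined to
  \<open>d\<close> by the new par link.\<close>

lemma forest_split_par:
  assumes hyp: "\<And>r x. r \<in> insert c O' \<Longrightarrow> x \<in> {a, b} \<Longrightarrow>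
      forest (add_mset (c, x) (star r (add_mset d I) + G))"
    and fresh: "a' \<noteq> b'" "{a', b'} \<inter> insert a (insert b (insert d (O' \<union> set_mset I \<union> vertices G))) = {}"
    and r: "r \<in> insert a (insert b O')" and y: "y \<in> {a', b'}"
  shows "forest (add_mset (d, y) (star r (add_mset a' (add_mset b' I)) + G))"
proof -
  obtain y' where y': "{#a', b'#} = {#y, y'#}" "y \<noteq> y'" "{y, y'} = {a', b'}"
    using y fresh(1) by fastforce
  \<comment> \<open>If \<open>r\<close> is the out-edge of another pair, the edge of the par link is
    dropped. Otherwise switch the par link to its premiss \<open>r\<close> and the sync link to
    \<open>c\<close>, recentre at \<open>r\<close> and drop the leaf \<open>c\<close>.\<close>
  have main: "forest (star r (add_mset d I) + G)"
  proof (cases "r \<in> O'")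
    case True
    then show ?thesis
      using hyp[of r a] by (simp add: forest_add)
  next
    case False
    then have "forest (star c (add_mset r (add_mset d I)) + G)"
      using r hyp[of c r] by simp
    then have "forest (star r (add_mset c (add_mset d I)) + G)"
      by (simp only: forest_recenter[of c r])
    then show ?thesis
      by (simp add: forest_add)
  qed
  have V: "vertices (star r I + G) \<subseteq> insert r (set_mset I \<union> vertices G)"
    using vertices_star[of r I] by auto
  have fr: "y \<notin> vertices (star r I + G)" "r \<noteq> y" "d \<noteq> y" "y' \<notin> vertices (star r I + G)" "r \<noteq> y'" "d \<noteq> y'"
    using V r fresh(2) y'(3) by auto
  \<comment> \<open>The edge from \<open>r\<close> to \<open>d\<close> is subdivided by the fresh
    \<open>y\<close>; the other fresh edge \<open>y'\<close> is then added as a leaf at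
    \<open>r\<close>.\<close>
  then have "forest (add_mset (r, y) (add_mset (d, y) (star r I + G)))"
    using forest_subdivide[of y "star r I + G" r d] main by simp
  then have "forest (add_mset (r, y') (add_mset (r, y) (add_mset (d, y) (star r I + G))))"
    using fr y'(2) by (subst forest_pendant) auto
  then have "forest (add_mset (d, y) (add_mset (r, y) (add_mset (r, y') (star r I)) + G))"
    by (simp add: add_mset_commute)
  moreover have "star r (add_mset a' (add_mset b' I)) = add_mset (r, y) (add_mset (r, y') (star r I))"
  proof -
    have "star r (add_mset a' (add_mset b' I)) = star r {#a', b'#} + star r I" by simp
    then show ?thesis unfolding y'(1) by simp
  qed
  ultimately show ?thesis
    by (simp only:)
qed

lemma switched_sync:
  "switched (Sync (xs @ z # ys)) =
    (\<lambda>r. star r (add_mset (in_edge z) (mset (map in_edge (xs @ ys))))) `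
      insert (out_edge z) (out_edge ` set (xs @ ys))"
  by (auto simp: image_iff)

lemma switched_sync2:
  "switched (Sync (xs @ z # z' # ys)) =
    (\<lambda>r. star r (add_mset (in_edge z) (add_mset (in_edge z') (mset (map in_edge (xs @ ys)))))) `
      insert (out_edge z) (insert (out_edge z') (out_edge ` set (xs @ ys)))"
  by (auto simp: image_iff)

lemma in_out_edge_pair:
  "in_edge (p, c) = (if positive (ty p) then p else c)"
  "out_edge (p, c) = (if positive (ty p) then c else p)"
  by (simp_all add: in_edge_def out_edge_def)

lemma positive_neg [simp]: "positive (neg A) = negative A"
  by (induction A) auto

lemma negative_neg [simp]: "negative (neg A) = positive A"
  by (induction A) auto

lemma positive_not_negative: "positive A \<Longrightarrow> \<not> negative A"
  by (cases A) auto

lemma net_switched2: "net_switched {#l, l'#} H \<longleftrightarrow> (\<exists>h\<in>switched l. \<exists>h'\<in>switched l'. H = h + h')"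
  by (auto simp: net_switched_add)

lemma in_out_sub: "in_edge ` set ps \<union> out_edge ` set ps \<subseteq> set_link (Sync ps)"
  by (intro Un_least image_subsetI subsetD[OF ends_set_link] in_edge_ends out_edge_ends)

text \<open>The two switchings of the par link show that neither \<open>d\<close> nor
  \<open>e\<close> is connected to \<open>a\<close> or \<open>b\<close> in the rest. As
  \<open>a\<close> and \<open>b\<close> are not connected to each other either, the two new cuts
  close no cycle, even if \<open>d\<close> and \<open>e\<close> are connected.\<close>

lemma tensor_par_net:
  assumes "smll_net ({#TensorL a b c, ParL d e f, k#} + K)" "k \<in> {Cut c f, Cut f c}"
  shows "smll_net ({#Cut a d, Cut b e#} + K) \<and>
    conclusions ({#Cut a d, Cut b e#} + K) = conclusions ({#TensorL a b c, ParL d e f, k#} + K)"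
proof (rule local_rewrite[OF assms(1), where X = "{#}" and D = "{#c, f#}" and Y = "{#a, b, d, e#}" and F = "{#}"])
  have wt: "\<forall>l\<in>#{#TensorL a b c, ParL d e f, k#} + K. well_typed l"
    using assms(1) unfolding smll_net_iff smll_structure_iff[of "_ + K"] by blast
  have "ty f = neg (ty c)"
    using wt assms(2) by auto
  then show "well_typed l" if "l \<in># {#Cut a d, Cut b e#}" for l
    using wt that by auto
next
  fix H' and G :: "('a edge \<times> 'a edge) multiset"
  assume H': "net_switched {#Cut a d, Cut b e#} H'"
    and old: "\<And>H. net_switched {#TensorL a b c, ParL d e f, k#} H \<Longrightarrow> forest (H + G)"
  have k: "\<exists>p\<in>{(c, f), (f, c)}. {#p#} \<in> switched k"
    using assms(2) by auto
  then obtain p where p: "p \<in> {(c, f), (f, c)}" "{#p#} \<in> switched k"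
    by blast
  have "forest ({#(c, a), (c, b)#} + ({#(f, x)#} + {#p#}) + G)" if "x \<in> {d, e}" for x
    using that p(2) by (intro old) (auto simp: net_switched_add)
  moreover have "{#(c, a), (c, b)#} + ({#(f, x)#} + {#p#}) + G =
      add_mset p (add_mset (f, x) (star c {#a, b#} + G))" for x
    by (simp add: add_mset_commute)
  ultimately have "forest (add_mset p (add_mset (f, x) (star c {#a, b#} + G)))" if "x \<in> {d, e}" for x
    using that by metis
  then have "forest (add_mset (c, f) (add_mset (f, x) (star c {#a, b#} + G)))" if "x \<in> {d, e}" for x
    using that p(1) forest_flip[of f c] by blast
  then have "forest (star c {#x, a, b#} + G)" if "x \<in> {d, e}" for x
    using that forest_contract1[of c f x "star c {#a, b#} + G"] by simp
  then have "forest G \<and> \<not> conn G x a \<and> \<not> conn G x b \<and> \<not> conn G a b" if "x \<in> {d, e}" for x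
    using that unfolding forest_star_iff by (simp add: pair_subset_add)
  from this[of d] this[of e] have "forest (add_mset (a, d) (add_mset (b, e) G))"
    using conn_commute[of G d a] conn_commute[of G d b] conn_commute[of G e a] conn_commute[of G e b]
    by (simp add: forest_add conn_add)
  moreover have "H' = {#(a, d), (b, e)#}"
    using H' by (simp add: net_switched_add)
  ultimately show "forest (H' + G)"
    by simp
qed (use assms(2) in auto)


lemma sync_tensor_net:
  assumes net: "smll_net ({#TensorL a b c, Sync (xs @ (c, d) # ys)#} + K)" (is "smll_net (?A + K)")
    and fresh: "a' \<notin> edges ({#TensorL a b c, Sync (xs @ (c, d) # ys)#} + K)" "b' \<notin> edges ({#TensorL a b c, Sync (xs @ (c, d) # ys)#} + K)" "a' \<noteq> b'" "ty a' = ty a" "ty b' = ty b"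
  shows "smll_net ({#TensorL a' b' d, Sync (xs @ (a, a') # (b, b') # ys)#} + K) \<and>
    conclusions ({#TensorL a' b' d, Sync (xs @ (a, a') # (b, b') # ys)#} + K) = conclusions ({#TensorL a b c, Sync (xs @ (c, d) # ys)#} + K)"
proof (rule local_rewrite[OF net, where D = "{#c#}" and F = "{#a', b'#}"
      and X = "mset (map snd (xs @ ys)) + {#d#}" and Y = "mset (map fst (xs @ ys)) + {#a, b#}"])
  have wt: "well_typed (TensorL a b c)" "well_typed (Sync (xs @ (c, d) # ys))"
    using net unfolding smll_net_iff smll_structure_iff[of "_ + K"] by auto
  then have pos: "positive (ty a)" "positive (ty b)" "ty c = ty a \<otimes> ty b" "ty d = ty a \<otimes> ty b"
    by auto
  show "well_typed l" if "l \<in># {#TensorL a' b' d, Sync (xs @ (a, a') # (b, b') # ys)#}" for l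
    using that wt pos fresh by auto
  fix H' and G :: "('a edge \<times> 'a edge) multiset"
  define I where "I = mset (map in_edge (xs @ ys))"
  define O' where "O' = out_edge ` set (xs @ ys)"
  assume H': "net_switched {#TensorL a' b' d, Sync (xs @ (a, a') # (b, b') # ys)#} H'"
    and G: "vertices G \<subseteq> edges (?A + K)"
    and old: "\<And>H. net_switched ?A H \<Longrightarrow> forest (H + G)"
  obtain r where r: "r \<in> insert a' (insert b' O')"
    "H' = {#(d, a'), (d, b')#} + star r (add_mset a (add_mset b I))"
  proof -
    have io: "in_edge (a, a') = a" "in_edge (b, b') = b" "out_edge (a, a') = a'" "out_edge (b, b') = b'"
      using pos by (simp_all add: in_out_edge_pair)
    show ?thesis
      using H' that unfolding net_switched2 switched_sync2 io I_def[symmetric] O'_def[symmetric] switched.simps(1-4)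
      by blast
  qed
  have "O' \<union> set_mset I \<subseteq> set_link (Sync (xs @ (c, d) # ys))"
    using in_out_sub[of "xs @ (c, d) # ys"] unfolding I_def O'_def by (simp add: image_Un del: link.set)
  then have "O' \<union> set_mset I \<subseteq> edges (?A + K)"
    by (auto simp del: link.set)
  moreover have "{a, b, d} \<subseteq> edges (?A + K)"
    using ends_set_link[of "Sync (xs @ (c, d) # ys)"] by simp
  ultimately have "{a', b'} \<inter> insert a (insert b (insert d (O' \<union> set_mset I \<union> vertices G))) = {}"
    using fresh(1,2) G by blast
  moreover have "forest (add_mset (c, a) (add_mset (c, b) (star s (add_mset c I) + G)))"
    if "s \<in> insert d O'" for s
  proof -
    have io: "in_edge (c, d) = c" "out_edge (c, d) = d"
      using pos by (simp_all add: in_out_edge_pair)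
    have "net_switched ?A ({#(c, a), (c, b)#} + star s (add_mset c I))"
      unfolding net_switched2 switched_sync io I_def[symmetric] O'_def[symmetric] using that by auto
    from old[OF this] show ?thesis by (simp add: add_mset_commute)
  qed
  ultimately show "forest (H' + G)"
    using forest_split_tensor[of d O' c a b I G a' b' r] r fresh(3) by (simp add: add_mset_commute)
qed (use fresh in auto)

lemma sync_par_net:
  assumes net: "smll_net ({#ParL a b c, Sync (xs @ (c, d) # ys)#} + K)" (is "smll_net (?A + K)")
    and fresh: "a' \<notin> edges ({#ParL a b c, Sync (xs @ (c, d) # ys)#} + K)" "b' \<notin> edges ({#ParL a b c, Sync (xs @ (c, d) # ys)#} + K)" "a' \<noteq> b'" "ty a' = ty a" "ty b' = ty b"
  shows "smll_net ({#ParL a' b' d, Sync (xs @ (a, a') # (b, b') # ys)#} + K) \<and>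
    conclusions ({#ParL a' b' d, Sync (xs @ (a, a') # (b, b') # ys)#} + K) = conclusions ({#ParL a b c, Sync (xs @ (c, d) # ys)#} + K)"
proof (rule local_rewrite[OF net, where D = "{#c#}" and F = "{#a', b'#}"
      and X = "mset (map snd (xs @ ys)) + {#d#}" and Y = "mset (map fst (xs @ ys)) + {#a, b#}"])
  have wt: "well_typed (ParL a b c)" "well_typed (Sync (xs @ (c, d) # ys))"
    using net unfolding smll_net_iff smll_structure_iff[of "_ + K"] by auto
  then have neg: "negative (ty a)" "negative (ty b)" "ty c = ty a \<parallel> ty b" "ty d = ty a \<parallel> ty b"
    by auto
  show "well_typed l" if "l \<in># {#ParL a' b' d, Sync (xs @ (a, a') # (b, b') # ys)#}" for l
    using that wt neg fresh by auto
  have np: "\<not> positive (ty a)" "\<not> positive (ty b)"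
    using neg positive_not_negative by blast+
  fix H' and G :: "('a edge \<times> 'a edge) multiset"
  define I where "I = mset (map in_edge (xs @ ys))"
  define O' where "O' = out_edge ` set (xs @ ys)"
  assume H': "net_switched {#ParL a' b' d, Sync (xs @ (a, a') # (b, b') # ys)#} H'"
    and G: "vertices G \<subseteq> edges (?A + K)"
    and old: "\<And>H. net_switched ?A H \<Longrightarrow> forest (H + G)"
  obtain r y where r: "r \<in> insert a (insert b O')" "y \<in> {a', b'}"
    "H' = {#(d, y)#} + star r (add_mset a' (add_mset b' I))"
  proof -
    have io: "in_edge (a, a') = a'" "in_edge (b, b') = b'" "out_edge (a, a') = a" "out_edge (b, b') = b"
      using np by (simp_all add: in_out_edge_pair)
    show ?thesis
      using H' that unfolding net_switched2 switched_sync2 io I_def[symmetric] O'_def[symmetric] switched.simps(1-4)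
      by blast
  qed
  have "O' \<union> set_mset I \<subseteq> set_link (Sync (xs @ (c, d) # ys))"
    using in_out_sub[of "xs @ (c, d) # ys"] unfolding I_def O'_def by (simp add: image_Un del: link.set)
  then have "O' \<union> set_mset I \<subseteq> edges (?A + K)"
    by (auto simp del: link.set)
  moreover have "{a, b, d} \<subseteq> edges (?A + K)"
    using ends_set_link[of "Sync (xs @ (c, d) # ys)"] by simp
  ultimately have "{a', b'} \<inter> insert a (insert b (insert d (O' \<union> set_mset I \<union> vertices G))) = {}"
    using fresh(1,2) G by blast
  moreover have "forest (add_mset (c, x) (star s (add_mset d I) + G))"
    if "s \<in> insert c O'" "x \<in> {a, b}" for s x
  proof -
    have io: "in_edge (c, d) = d" "out_edge (c, d) = c"
      using neg by (simp_all add: in_out_edge_pair)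
    have "net_switched ?A ({#(c, x)#} + star s (add_mset d I))"
      unfolding net_switched2 switched_sync io I_def[symmetric] O'_def[symmetric] using that by auto
    from old[OF this] show ?thesis by (simp add: add_mset_commute)
  qed
  ultimately show "forest (H' + G)"
    using forest_split_par[of c O' a b d I G a' b' r y] r fresh(3) by (simp add: add_mset_commute)
qed (use fresh in auto)

lemma sync_ax_net:
  assumes net: "smll_net ({#l, Sync (xs @ (a, a') # ys)#} + K)" (is "smll_net (?A + K)")
    and l: "l \<in> {Ax a b, Ax b a}" and pos: "positive (ty a)"
    and fresh: "b' \<notin> edges ({#l, Sync (xs @ (a, a') # ys)#} + K)" "ty b' = ty b"
  shows "smll_net ({#Ax a' b', Sync (xs @ (b', b) # ys)#} + K) \<and>
    conclusions ({#Ax a' b', Sync (xs @ (b', b) # ys)#} + K) = conclusions ({#l, Sync (xs @ (a, a') # ys)#} + K)"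
proof (rule local_rewrite[OF net, where D = "{#a#}" and F = "{#b'#}"
      and X = "mset (map snd (xs @ ys)) + {#b, a'#}" and Y = "mset (map fst (xs @ ys))"])
  have wt: "well_typed l" "well_typed (Sync (xs @ (a, a') # ys))"
    using net unfolding smll_net_iff smll_structure_iff[of "_ + K"] by auto
  then have tys: "ty a' = ty a" "ty b = neg (ty a)"
    using l by auto
  show "well_typed k" if "k \<in># {#Ax a' b', Sync (xs @ (b', b) # ys)#}" for k
    using that wt tys fresh pos by auto
  have np: "\<not> positive (ty b)"
    using tys pos positive_not_negative by auto
  fix H' and G :: "('a edge \<times> 'a edge) multiset"
  define I where "I = mset (map in_edge (xs @ ys))"
  define O' where "O' = out_edge ` set (xs @ ys)"
  assume H': "net_switched {#Ax a' b', Sync (xs @ (b', b) # ys)#} H'"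
    and G: "vertices G \<subseteq> edges (?A + K)"
    and old: "\<And>H. net_switched ?A H \<Longrightarrow> forest (H + G)"
  obtain r where r: "r \<in> insert b' O'" "H' = {#(a', b')#} + star r (add_mset b I)"
  proof -
    have io: "in_edge (b', b) = b" "out_edge (b', b) = b'"
      using np fresh(2) by (simp_all add: in_out_edge_pair)
    show ?thesis
      using H' that unfolding net_switched2 switched_sync io I_def[symmetric] O'_def[symmetric] switched.simps(1-4)
      by blast
  qed
  have "O' \<union> set_mset I \<subseteq> set_link (Sync (xs @ (a, a') # ys))"
    using in_out_sub[of "xs @ (a, a') # ys"] unfolding I_def O'_def by (simp add: image_Un del: link.set)
  then have "O' \<union> set_mset I \<subseteq> edges (?A + K)"
    by (auto simp del: link.set)
  moreover have "{a', b} \<subseteq> edges (?A + K)"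
    using ends_set_link[of "Sync (xs @ (a, a') # ys)"] l by auto
  ultimately have "b' \<notin> insert a' (insert b (O' \<union> set_mset I \<union> vertices G))"
    using fresh(1) G by blast
  moreover have "forest (add_mset (a, b) (star s (add_mset a I) + G))"
    if "s \<in> insert a' O'" for s
  proof -
    have io: "in_edge (a, a') = a" "out_edge (a, a') = a'"
      using pos by (simp_all add: in_out_edge_pair)
    obtain p where p: "p \<in> {(a, b), (b, a)}" "{#p#} \<in> switched l"
      using l by auto
    have "net_switched ?A ({#p#} + star s (add_mset a I))"
      unfolding net_switched2 switched_sync io I_def[symmetric] O'_def[symmetric] using that p(2) by blast
    from old[OF this] have "forest (add_mset p (star s (add_mset a I) + G))"
      by (simp add: add_mset_commute)
    then show ?thesis using p(1) forest_flip[of b a] by blast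
  qed
  ultimately show "forest (H' + G)"
    using forest_move_sync[of a' O' a b I G b' r] r by (simp add: add_mset_commute)
qed (use l fresh in auto)

lemma sync_cut_net:
  assumes net: "smll_net ({#k, Sync (xs @ (n, n') # ys)#} + K)" (is "smll_net (?A + K)")
    and k: "k \<in> {Cut n' p, Cut p n'}" and neg: "negative (ty n')"
    and fresh: "p' \<notin> edges ({#k, Sync (xs @ (n, n') # ys)#} + K)" "ty p' = ty p"
  shows "smll_net ({#Cut n p', Sync (xs @ (p, p') # ys)#} + K) \<and>
    conclusions ({#Cut n p', Sync (xs @ (p, p') # ys)#} + K) = conclusions ({#k, Sync (xs @ (n, n') # ys)#} + K)"
proof (rule local_rewrite[OF net, where D = "{#n'#}" and F = "{#p'#}"
      and X = "mset (map snd (xs @ ys))" and Y = "mset (map fst (xs @ ys)) + {#n, p#}"])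
  have wt: "well_typed k" "well_typed (Sync (xs @ (n, n') # ys))"
    using net unfolding smll_net_iff smll_structure_iff[of "_ + K"] by auto
  then have tys: "ty n = ty n'" "ty p = neg (ty n')"
    using k by auto
  show "well_typed l" if "l \<in># {#Cut n p', Sync (xs @ (p, p') # ys)#}" for l
    using that wt tys fresh neg by auto
  have np: "\<not> positive (ty n)" "positive (ty p)"
    using tys neg positive_not_negative by auto
  fix H' and G :: "('a edge \<times> 'a edge) multiset"
  define I where "I = mset (map in_edge (xs @ ys))"
  define O' where "O' = out_edge ` set (xs @ ys)"
  assume H': "net_switched {#Cut n p', Sync (xs @ (p, p') # ys)#} H'"
    and G: "vertices G \<subseteq> edges (?A + K)"
    and old: "\<And>H. net_switched ?A H \<Longrightarrow> forest (H + G)"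
  obtain r where r: "r \<in> insert p' O'" "H' = {#(n, p')#} + star r (add_mset p I)"
  proof -
    have io: "in_edge (p, p') = p" "out_edge (p, p') = p'"
      using np fresh(2) by (simp_all add: in_out_edge_pair)
    show ?thesis
      using H' that unfolding net_switched2 switched_sync io I_def[symmetric] O'_def[symmetric] switched.simps(1-4)
      by blast
  qed
  have "O' \<union> set_mset I \<subseteq> set_link (Sync (xs @ (n, n') # ys))"
    using in_out_sub[of "xs @ (n, n') # ys"] unfolding I_def O'_def by (simp add: image_Un del: link.set)
  then have "O' \<union> set_mset I \<subseteq> edges (?A + K)"
    by (auto simp del: link.set)
  moreover have "{n, p} \<subseteq> edges (?A + K)"
    using ends_set_link[of "Sync (xs @ (n, n') # ys)"] k by auto
  ultimately have "p' \<notin> insert n (insert p (O' \<union> set_mset I \<union> vertices G))"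
    using fresh(1) G by blast
  moreover have "forest (add_mset (n', p) (star s (add_mset n' I) + G))"
    if "s \<in> insert n O'" for s
  proof -
    have io: "in_edge (n, n') = n'" "out_edge (n, n') = n"
      using np by (simp_all add: in_out_edge_pair)
    obtain q where q: "q \<in> {(n', p), (p, n')}" "{#q#} \<in> switched k"
      using k by auto
    have "net_switched ?A ({#q#} + star s (add_mset n' I))"
      unfolding net_switched2 switched_sync io I_def[symmetric] O'_def[symmetric] using that q(2) by blast
    from old[OF this] have "forest (add_mset q (star s (add_mset n' I) + G))"
      by (simp add: add_mset_commute)
    then show ?thesis using q(1) forest_flip[of p n'] by blast
  qed
  ultimately show "forest (H' + G)"
    using forest_move_sync[of n O' n' p I G p' r] r by (simp add: add_mset_commute)
qed (use k fresh in auto)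

lemma all_concls_ones [simp]: "all_concls (mset (map (OneL \<circ> f) ps)) = mset (map f ps)"
  by (induction ps) auto

lemma all_prems_ones [simp]: "all_prems (mset (map (OneL \<circ> f) ps)) = {#}"
  by (induction ps) auto

lemma net_switched_ones [simp]: "net_switched (mset (map (OneL \<circ> f) ps)) H \<longleftrightarrow> H = {#}"
  by (induction ps arbitrary: H) (auto simp: net_switched_add)

lemma switched_nonempty: "switched l \<noteq> {}"
  by (cases l) auto

lemma sync_one_net:
  assumes net: "smll_net ({#Sync ps#} + mset (map (OneL \<circ> fst) ps) + K)" (is "smll_net (?A + K)")
  shows "smll_net (mset (map (OneL \<circ> snd) ps) + K) \<and>
    conclusions (mset (map (OneL \<circ> snd) ps) + K) = conclusions ({#Sync ps#} + mset (map (OneL \<circ> fst) ps) + K)"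
proof (rule local_rewrite[OF net, where D = "mset (map fst ps)" and F = "{#}"
      and X = "mset (map snd ps)" and Y = "{#}"])
  have wt: "\<forall>l\<in>#?A. well_typed l"
    using net unfolding smll_net_iff smll_structure_iff[of "_ + K"] by auto
  show "well_typed l" if "l \<in># mset (map (OneL \<circ> snd) ps)" for l
    using that wt by fastforce
  fix H' and G :: "('a edge \<times> 'a edge) multiset"
  assume H': "net_switched (mset (map (OneL \<circ> snd) ps)) H'"
    and old: "\<And>H. net_switched ?A H \<Longrightarrow> forest (H + G)"
  obtain h where "h \<in> switched (Sync ps)"
    using switched_nonempty by blast
  then have "net_switched ?A h"
    by (auto simp: net_switched_add net_switched_union simp del: switched.simps mset_map)
  then show "forest (H' + G)"
    using old[of h] H' forest_mono[of G h] by (simp add: add.commute del: mset_map)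
qed (auto simp del: mset_map)

section \<open>Opening a box\<close>

lemma net_switched_addI:
  "h \<in> switched l \<Longrightarrow> net_switched N H \<Longrightarrow> net_switched (add_mset l N) (h + H)"
  by (auto simp: net_switched_add)

lemma pair_subset: "x \<noteq> y \<Longrightarrow> x \<in># Z \<Longrightarrow> y \<in># Z \<Longrightarrow> {#x, y#} \<subseteq># Z"
  by (auto simp: insert_subset_eq_iff in_diff_count)

lemma conclusions_add_prems: "linear M \<Longrightarrow> conclusions M + all_prems M = all_concls M"
  unfolding linear_def conclusions_def by (simp add: subset_mset.diff_add)

text \<open>The star of the box keeps the border edges pairwise disconnected outside, and inside and
  outside share only border edges, as hidden ones are private. The two forests are therefore glued
  along the border.\<close>

lemma box_one_net:
  assumes net: "smll_net ({#BotBox e \<Gamma> M, OneL a, k#} + K)" and k: "k \<in> {Cut e a, Cut a e}"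
  shows "smll_net (M + K) \<and> conclusions (M + K) = conclusions ({#BotBox e \<Gamma> M, OneL a, k#} + K)"
proof -
  let ?N = "{#BotBox e \<Gamma> M, OneL a, k#} + K"
  have st: "smll_structure ?N" and ac: "acyc ?N"
    and co: "\<And>e \<Gamma> M. BotBox e \<Gamma> M \<in># ?N \<Longrightarrow> correct M"
    using net unfolding smll_net_iff by blast+
  have lin: "linear ?N" and wt: "\<forall>l\<in>#?N. well_typed l"
    and box: "\<And>e \<Gamma> M. BotBox e \<Gamma> M \<in># ?N \<Longrightarrow> smll_structure M \<and> \<Gamma> = conclusions M \<and>
      (edges M - set_mset \<Gamma>) \<inter> insert e (edges (?N - {#BotBox e \<Gamma> M#})) = {}"
    using st unfolding smll_structure_iff[of ?N] by blast+
  have M: "smll_structure M" "\<Gamma> = conclusions M" "(edges M - set_mset \<Gamma>) \<inter> edges K = {}" "correct M"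
    using box[of e \<Gamma> M] co[of e \<Gamma> M] by auto
  then have netM: "smll_net M"
    by (simp add: smll_net_def)
  have linM: "linear M"
    using M(1) smll_structure_iff by blast
  have cM: "all_concls M = \<Gamma> + all_prems M"
    using conclusions_add_prems[OF linM] M(2) by simp
  have pk: "prems k = {#e, a#}" "concls k = {#}"
    using k by auto
  have "linear (M + K)"
    unfolding linear_def
  proof (intro conjI allI)
    fix x
    have \<Gamma>K: "count \<Gamma> x + count (all_concls K) x \<le> 1"
      using linear_concls[OF lin, of x] by (simp split: if_splits)
    show "count (all_concls (M + K)) x \<le> 1"
    \<comment> \<open>A premiss inside \<open>M\<close> is hidden, because linearity keeps it out of
      the border; so it does not occur in \<open>K\<close>.\<close>
    proof (cases "x \<in># all_prems M")
      case True
      have "count (all_prems M) x = 1" "count (all_concls M) x \<le> 1"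
        using True linear_prems[OF linM, of x] linear_concls[OF linM, of x]
        by (auto simp flip: count_greater_zero_iff)
      then have "x \<notin># \<Gamma>"
        unfolding cM by (simp add: not_in_iff)
      moreover have "x \<in> edges M"
        using True mset_edges[of M] by auto
      ultimately have "x \<notin> edges K"
        using M(3) by blast
      then have "x \<notin># all_concls K"
        using mset_edges[of K] by auto
      then show ?thesis
        using linear_concls[OF linM, of x] by (simp add: not_in_iff)
    next
      case False
      then show ?thesis
        using \<Gamma>K by (simp add: cM not_in_iff)
    qed
    have "{#e, a#} + all_prems K \<subseteq># {#e, a#} + (\<Gamma> + all_concls K)"
      using lin unfolding linear_def by (simp add: pk add_mset_commute)
    then have "all_prems K \<subseteq># \<Gamma> + all_concls K"
      by simp
    then show "all_prems (M + K) \<subseteq># all_concls (M + K)"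
      by (simp add: cM ac_simps)
  qed
  moreover have "\<forall>l\<in>#M + K. well_typed l"
    using wt M(1) by (auto simp: smll_structure_iff[of M])
  moreover have "smll_structure M' \<and> \<Gamma>' = conclusions M' \<and>
      (edges M' - set_mset \<Gamma>') \<inter> insert e' (edges (M + K - {#BotBox e' \<Gamma>' M'#})) = {} \<and> correct M'"
    if "BotBox e' \<Gamma>' M' \<in># M + K" for e' \<Gamma>' M'
  proof (cases "BotBox e' \<Gamma>' M' \<in># M")
    case True
    then obtain R where R: "M = add_mset (BotBox e' \<Gamma>' M') R"
      by (auto dest: multi_member_split)
    have *: "smll_structure M'" "\<Gamma>' = conclusions M'" "correct M'"
      "(edges M' - set_mset \<Gamma>') \<inter> insert e' (edges R) = {}"
      using M(1) netM True unfolding smll_structure_iff[of M] smll_net_iff[of M] by (auto simp: R)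
    \<comment> \<open>An edge hidden in the inner box could meet \<open>K\<close> only on the border
      of the outer one. It would then be a conclusion of a link of \<open>M\<close>, which an edge
      hidden in the inner box is not.\<close>
    have "x \<notin> edges K" if x: "x \<in> edges M' - set_mset \<Gamma>'" for x
    proof
      assume "x \<in> edges K"
      moreover have "x \<in> edges M"
        using x by (auto simp: R edges_def)
      ultimately have "x \<in># all_concls M"
        using M(3) cM by auto
      then show False
        using x *(4) mset_edges[of R] by (auto simp: R)
    qed
    then show ?thesis
      using * by (auto simp: R)
  next
    case False
    then have "BotBox e' \<Gamma>' M' \<in># K"
      using that by simp
    then obtain R where R: "K = add_mset (BotBox e' \<Gamma>' M') R"
      by (auto dest: multi_member_split)
    have "?N - {#BotBox e' \<Gamma>' M'#} = {#BotBox e \<Gamma> M, OneL a, k#} + R"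
      by (simp add: R)
    moreover have "M + K - {#BotBox e' \<Gamma>' M'#} = M + R"
      by (simp add: R)
    moreover have "edges M \<subseteq> edges {#BotBox e \<Gamma> M, OneL a, k#}"
      by (auto simp: edges_def)
    ultimately show ?thesis
      using box[of e' \<Gamma>' M'] co[of e' \<Gamma>' M'] R by auto
  qed
  moreover have "acyc (M + K)"
    unfolding acyc_def
  proof (intro allI impI)
    fix H assume "net_switched (M + K) H"
    then obtain HM G where H: "net_switched M HM" "net_switched K G" "H = HM + G"
      by (auto simp: net_switched_union)
    obtain p where "{#p#} \<in> switched k"
      using k by auto
    then have "net_switched (add_mset k K) ({#p#} + G)"
      using net_switched_addI H(2) by blast
    then have "net_switched (add_mset (OneL a) (add_mset k K)) ({#} + ({#p#} + G))"
      by (rule net_switched_addI[rotated]) simp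
    then have "net_switched (add_mset (BotBox e \<Gamma> M) (add_mset (OneL a) (add_mset k K)))
        (star e \<Gamma> + ({#} + ({#p#} + G)))"
      by (rule net_switched_addI[rotated]) simp
    then have "forest (star e \<Gamma> + G + {#p#})"
      using ac unfolding acyc_def by (simp add: ac_simps)
    then have G: "forest G" "\<And>x y. {#x, y#} \<subseteq># add_mset e \<Gamma> \<Longrightarrow> \<not> conn G x y"
      using forest_mono forest_star_iff by metis+
    have "x = y" if "x \<in> edges M" "y \<in> edges M" "conn G x y" for x y
    proof (rule ccontr)
      assume "x \<noteq> y"
      moreover from this have "x \<in> edges K" "y \<in> edges K"
        using conn_vertices[OF that(3)] net_switched_edges[OF H(2)] by auto
      then have "x \<in># \<Gamma>" "y \<in># \<Gamma>"
        using M(3) that by auto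
      ultimately show False
        using G(2)[of x y] that(3) by (simp add: pair_subset)
    qed
    moreover have "forest HM"
      using netM H(1) unfolding smll_net_iff acyc_def by blast
    ultimately show "forest H"
      using forest_glue[OF G(1) _ net_switched_edges[OF H(1)]] H(3) by blast
  qed
  moreover have "conclusions (M + K) = conclusions ?N"
    using conclusions_cancel[of ?N "\<Gamma> + all_concls K" "{#e, a#}" "all_prems K"]
      conclusions_cancel[of "M + K" "\<Gamma> + all_concls K" "all_prems M" "all_prems K"]
    by (simp add: cM pk ac_simps)
  ultimately show ?thesis
    unfolding smll_net_iff smll_structure_iff[of "M + K"] by blast
qed

section \<open>Renaming\<close>

lemma prems_map_link [simp]: "prems (map_link f l) = image_mset f (prems l)"
  by (cases l) (auto simp: multiset.map_comp comp_def)

lemma concls_map_link [simp]: "concls (map_link f l) = image_mset f (concls l)"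
  by (cases l) (auto simp: multiset.map_comp comp_def)

lemma all_prems_map [simp]: "all_prems (image_mset (map_link f) N) = image_mset f (all_prems N)"
  by (induction N) auto

lemma all_concls_map [simp]: "all_concls (image_mset (map_link f) N) = image_mset f (all_concls N)"
  by (induction N) auto

lemma edges_map [simp]: "edges (image_mset (map_link f) N) = f ` edges N"
  by (auto simp: edges_def link.set_map)

lemma well_typed_map_link:
  "(\<And>e. ty (f e) = ty e) \<Longrightarrow> well_typed (map_link f l) \<longleftrightarrow> well_typed l"
  by (cases l) (auto simp: split_beta)

lemma switched_map_link:
  assumes "\<And>e. ty (f e) = ty e"
  shows "switched (map_link f l) = image_mset (map_prod f f) ` switched l"
proof (cases l)
  case (Sync ps)
  have io: "in_edge (map_prod f f z) = f (in_edge z)" "out_edge (map_prod f f z) = f (out_edge z)" for z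
    by (simp_all add: in_edge_def out_edge_def assms)
  have "switched (Sync ps) = (\<lambda>r. star r (mset (map in_edge ps))) ` out_edge ` set ps" if "ps \<noteq> []" for ps :: "('a edge \<times> 'a edge) list"
    using that by auto
  then show ?thesis
    using Sync by (cases "ps = []")
      (simp, simp add: image_image io multiset.map_comp comp_def del: switched.simps(7))
qed (auto simp: multiset.map_comp comp_def)

lemma net_switched_map_link:
  assumes "\<And>e. ty (f e) = ty e" "net_switched (image_mset (map_link f) N) H"
  obtains G where "net_switched N G" "H = image_mset (map_prod f f) G"
proof -
  have "\<exists>G. net_switched N G \<and> H = image_mset (map_prod f f) G"
    using assms(2)
  proof (induction N arbitrary: H)
    case (add l N)
    then obtain h H' where H: "h \<in> switched (map_link f l)"
      "net_switched (image_mset (map_link f) N) H'" "H = h + H'"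
      by (auto simp: net_switched_add)
    from add.IH[OF this(2)] obtain G where "net_switched N G" "H' = image_mset (map_prod f f) G"
      by blast
    moreover obtain g where "g \<in> switched l" "h = image_mset (map_prod f f) g"
      using H(1) unfolding switched_map_link[OF assms(1)] by blast
    ultimately show ?case
      using H(3) by (intro exI[of _ "g + G"]) (auto simp: net_switched_add)
  qed simp
  then show ?thesis using that by blast
qed

lemma conn_inj: "inj f \<Longrightarrow> conn (image_mset (map_prod f f) M) (f x) (f y) \<longleftrightarrow> conn M x y"
  by (induction M arbitrary: x y) (auto simp: conn_add inj_eq)

lemma forest_inj: "inj f \<Longrightarrow> forest (image_mset (map_prod f f) M) \<longleftrightarrow> forest M"
  by (induction M) (auto simp: forest_add conn_inj)

lemma count_inj_le:
  assumes "inj f" "\<forall>x. count A x \<le> n"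
  shows "count (image_mset f A) y \<le> n"
proof (cases "y \<in> range f")
  case True
  have "count (image_mset f A) (f x) = count A x" for x
    by (induction A) (auto simp: inj_eq[OF assms(1)])
  then show ?thesis using True assms(2) by auto
next
  case False
  then have "y \<notin># image_mset f A" by auto
  then have "count (image_mset f A) y = 0" by (simp only: not_in_iff)
  then show ?thesis by simp
qed

lemma conclusions_map:
  "linear M \<Longrightarrow> conclusions (image_mset (map_link f) M) = image_mset f (conclusions M)"
  by (simp add: conclusions_def linear_def image_mset_Diff)

lemma box_map_link:
  assumes "BotBox e' \<Gamma>' M' \<in># image_mset (map_link f) N"
  obtains e \<Gamma> M where "BotBox e \<Gamma> M \<in># N" "e' = f e" "\<Gamma>' = image_mset f \<Gamma>"
    "M' = image_mset (map_link f) M"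
    "image_mset (map_link f) N - {#BotBox e' \<Gamma>' M'#} = image_mset (map_link f) (N - {#BotBox e \<Gamma> M#})"
proof -
  obtain l where l: "l \<in># N" "BotBox e' \<Gamma>' M' = map_link f l"
    using assms by auto
  then obtain e \<Gamma> M where [simp]: "l = BotBox e \<Gamma> M"
    by (cases l) auto
  have "image_mset (map_link f) (N - {#l#}) = image_mset (map_link f) N - {#map_link f l#}"
    using l(1) by (simp add: image_mset_Diff)
  then show ?thesis
    using that[of e \<Gamma> M] l by simp
qed

text \<open>Used for box contents, into which the axiom/cut rule renames. The induction descends
  into nested boxes; injectivity keeps edges apart at every depth.\<close>

lemma smll_net_rename:
  assumes "smll_structure N" "correct N" "inj f" "\<And>e. ty (f e) = ty e"
  shows "smll_net (image_mset (map_link f) N)"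
  using assms(1,2)
proof (induction rule: smll_structure.induct)
  case (1 N)
  let ?N = "image_mset (map_link f) N"
  have "smll_structure N"
    by (rule smll_structure.intros) (use 1 in blast)+
  then have net: "smll_net N"
    unfolding smll_net_def using 1 by blast
  then have lin: "linear N" and ac: "acyc N"
    unfolding smll_net_iff smll_structure_iff[of N] by simp_all
  have box: "correct M \<and> smll_net (image_mset (map_link f) M) \<and> smll_structure M \<and> \<Gamma> = conclusions M \<and>
      (edges M - set_mset \<Gamma>) \<inter> insert e (edges (N - {#BotBox e \<Gamma> M#})) = {}"
    if "BotBox e \<Gamma> M \<in># N" for e \<Gamma> M
    using 1(4)[rule_format, OF that] 1(5) that unfolding correct_iff[of N] by blast
  have "linear ?N"
    using lin count_inj_le[OF assms(3)] unfolding linear_def by (auto intro: image_mset_subseteq_mono)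
  moreover have "\<forall>l\<in>#?N. well_typed l"
    using 1(1) assms(4) by (auto simp: well_typed_map_link)
  moreover have "smll_structure M' \<and> \<Gamma>' = conclusions M' \<and>
      (edges M' - set_mset \<Gamma>') \<inter> insert e' (edges (?N - {#BotBox e' \<Gamma>' M'#})) = {} \<and> correct M'"
    if B: "BotBox e' \<Gamma>' M' \<in># ?N" for e' \<Gamma>' M'
  proof -
    from box_map_link[OF B] obtain e \<Gamma> M where b: "BotBox e \<Gamma> M \<in># N" "e' = f e" "\<Gamma>' = image_mset f \<Gamma>"
      "M' = image_mset (map_link f) M" "?N - {#BotBox e' \<Gamma>' M'#} = image_mset (map_link f) (N - {#BotBox e \<Gamma> M#})"
      by blast
    have "linear M"
      using box[OF b(1)] smll_structure_iff by blast
    then have "\<Gamma>' = conclusions M'"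
      using box[OF b(1)] b by (simp add: conclusions_map)
    moreover have "f ` (edges M - set_mset \<Gamma>) \<inter> f ` insert e (edges (N - {#BotBox e \<Gamma> M#})) = {}"
      using box[OF b(1)] image_Int[OF assms(3)] by (metis image_empty)
    then have "(edges M' - set_mset \<Gamma>') \<inter> insert e' (edges (?N - {#BotBox e' \<Gamma>' M'#})) = {}"
      unfolding b(5) using b(2,3,4) image_set_diff[OF assms(3)] by simp
    ultimately show ?thesis
      using box[OF b(1)] b(4) by (simp add: smll_net_def)
  qed
  moreover have "acyc ?N"
    unfolding acyc_def
  proof (intro allI impI)
    fix H assume "net_switched ?N H"
    then obtain G where "net_switched N G" "H = image_mset (map_prod f f) G"
      using net_switched_map_link[OF assms(4)] by blast
    then show "forest H"
      using ac forest_inj[OF assms(3)] unfolding acyc_def by blast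
  qed
  ultimately show ?case
    unfolding smll_net_iff smll_structure_iff[of ?N] by blast
qed

lemma net_switched_exists: "\<exists>H. net_switched N H"
proof (induction N)
  case (add l N)
  then show ?case using switched_nonempty[of l] by (auto simp: net_switched_add)
qed simp

lemma neg_neq: "neg A \<noteq> A"
  by (cases A) auto

text \<open>In every switching the axiom and the cut form a path from \<open>a\<close> through
  \<open>b\<close> to \<open>c\<close>. It contracts to an edge, and the renaming identifies the
  ends of that edge by \<open>forest_identify\<close>.\<close>

lemma ax_cut_net:
  assumes net: "smll_net ({#l, k#} + K)"
    and l: "l \<in> {Ax a b, Ax b a}" and k: "k \<in> {Cut b c, Cut c b}"
  defines "ren \<equiv> \<lambda>e. if e = c then a else e"
  shows "smll_net (image_mset (map_link ren) K) \<and>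
    conclusions (image_mset (map_link ren) K) = conclusions ({#l, k#} + K)"
proof -
  let ?N = "{#l, k#} + K" and ?N' = "image_mset (map_link ren) K"
  have st: "smll_structure ?N" and ac: "acyc ?N"
    and co: "\<And>e \<Gamma> M. BotBox e \<Gamma> M \<in># ?N \<Longrightarrow> correct M"
    using net unfolding smll_net_iff by blast+
  have lin: "linear ?N" and wt: "\<forall>l\<in>#?N. well_typed l"
    and box: "\<And>e \<Gamma> M. BotBox e \<Gamma> M \<in># ?N \<Longrightarrow> smll_structure M \<and> \<Gamma> = conclusions M \<and>
      (edges M - set_mset \<Gamma>) \<inter> insert e (edges (?N - {#BotBox e \<Gamma> M#})) = {}"
    using st unfolding smll_structure_iff[of ?N] by blast+
  have tys: "ty b = neg (ty a)" "ty c = neg (ty b)"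
    using l k wt by auto
  then have tyc: "ty c = ty a"
    by simp
  have bc: "b \<noteq> c"
    using tys(2) neg_neq by metis
  have ren_ty: "ty (ren e) = ty e" for e
    using tyc by (simp add: ren_def)
  have pk: "prems k = {#b, c#}" "concls k = {#}" "prems l = {#}" "concls l = {#a, b#}"
    using l k by auto
  have forest_ac: "forest (add_mset (a, c) G)" if G: "net_switched K G" for G
  proof -
    obtain p q where pq: "p \<in> {(a, b), (b, a)}" "{#p#} \<in> switched l"
      "q \<in> {(b, c), (c, b)}" "{#q#} \<in> switched k"
      using l k by auto
    have "net_switched (add_mset l (add_mset k K)) ({#p#} + ({#q#} + G))"
      using pq(2,4) G by (intro net_switched_addI)
    moreover have "acyc (add_mset l (add_mset k K))"
      using ac by simp
    ultimately have "forest ({#p#} + ({#q#} + G))"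
      unfolding acyc_def by blast
    then have "forest (add_mset p (add_mset q G))"
      by (simp add: add_mset_commute)
    then have "forest (add_mset (a, b) (add_mset q G))"
      using pq(1) forest_flip[of b a] by blast
    then have "forest (add_mset q (add_mset (a, b) G))"
      by (simp add: add_mset_commute)
    then have "forest (add_mset (b, c) (add_mset (a, b) G))"
      using pq(3) forest_flip[of c b] by blast
    then show ?thesis
      using forest_contract1[of a b c G] by (simp add: add_mset_commute)
  qed
  \<comment> \<open>If \<open>a\<close> and \<open>c\<close> coincided, the axiom and the cut would
    form a cycle.\<close>
  have ac_ne: "a \<noteq> c"
    using net_switched_exists[of K] forest_ac by (auto simp: forest_add)
  have cK: "c \<in># all_concls K"
  proof -
    have "c \<in># all_concls ?N"
      using lin unfolding linear_def by (rule mset_subset_eqD[OF conjunct2]) (simp add: pk)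
    then show ?thesis
      using ac_ne bc by (auto simp: pk)
  qed
  then obtain C where C: "all_concls K = add_mset c C"
    by (auto dest: multi_member_split)
  have count: "count (add_mset a C) x \<le> 1" "c \<notin># C" "a \<notin># all_concls K" for x
    using linear_concls[OF lin, of x] linear_concls[OF lin, of c] linear_concls[OF lin, of a]
    by (auto simp: pk C not_in_iff split: if_splits)
  have cP: "c \<notin># all_prems K"
    using linear_prems[OF lin, of c] by (simp add: pk not_in_iff split: if_splits)
  have ren_id: "image_mset ren A = A" if "c \<notin># A" for A
    using that by (induction A) (auto simp: ren_def)
  have new: "all_concls ?N' = add_mset a C" "all_prems ?N' = all_prems K"
    using ren_id count(2) cP by (simp_all add: C ren_def)
  have sub: "all_prems K \<subseteq># add_mset a C"
  proof -
    have "{#b, c#} + all_prems K \<subseteq># {#b, c#} + add_mset a C"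
      using lin unfolding linear_def by (simp add: pk C add_mset_commute)
    then show ?thesis by simp
  qed
  have "linear ?N'"
    unfolding linear_def new using count(1) sub by blast
  moreover have "\<forall>l\<in>#?N'. well_typed l"
    using wt ren_ty by (auto simp: well_typed_map_link)
  moreover have "smll_structure M' \<and> \<Gamma>' = conclusions M' \<and>
      (edges M' - set_mset \<Gamma>') \<inter> insert e' (edges (?N' - {#BotBox e' \<Gamma>' M'#})) = {} \<and> correct M'"
    if B: "BotBox e' \<Gamma>' M' \<in># ?N'" for e' \<Gamma>' M'
  proof -
    from box_map_link[OF B] obtain e \<Gamma> M where b: "BotBox e \<Gamma> M \<in># K" "e' = ren e" "\<Gamma>' = image_mset ren \<Gamma>"
      "M' = image_mset (map_link ren) M"
      "?N' - {#BotBox e' \<Gamma>' M'#} = image_mset (map_link ren) (K - {#BotBox e \<Gamma> M#})"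
      by blast
    then obtain R where R: "K = add_mset (BotBox e \<Gamma> M) R"
      by (auto dest: multi_member_split)
    let ?hid = "edges M - set_mset \<Gamma>"
    have M: "smll_structure M" "\<Gamma> = conclusions M" "correct M"
      "?hid \<inter> insert e (edges ({#l, k#} + R)) = {}"
      using box[of e \<Gamma> M] co[of e \<Gamma> M] by (auto simp: R)
    have "a \<in> edges {#l, k#}" "c \<in> edges {#l, k#}"
      using mset_edges[of "{#l, k#}"] by (auto simp: pk)
    then have hid: "a \<notin> ?hid" "c \<notin> ?hid"
      using M(4) by auto
    have "a \<notin># \<Gamma>"
      using count(3) by (auto simp: R)
    then have aM: "a \<notin> edges M"
      using hid by blast
    \<comment> \<open>The map \<open>ren\<close> is not injective, but \<open>a\<close> occurs
      neither hidden in the box nor on its border. There \<open>ren\<close> acts like the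
      transposition of \<open>a\<close> and \<open>c\<close>, to which
      \<open>smll_net_rename\<close> applies.\<close>
    define s where "s = (\<lambda>x. if x = c then a else if x = a then c else x)"
    have s: "inj s" "\<And>x. ty (s x) = ty x"
      using tyc by (auto simp: inj_def s_def)
    have "map_link ren m = map_link s m" if "m \<in># M" for m
      using that aM by (intro link.map_cong0) (auto simp: ren_def s_def edges_def)
    then have M': "M' = image_mset (map_link s) M"
      unfolding b(4) by (rule image_mset_cong)
    have G': "\<Gamma>' = image_mset s \<Gamma>"
      unfolding b(3) using \<open>a \<notin># \<Gamma>\<close> by (intro image_mset_cong) (auto simp: ren_def s_def)
    have "linear M"
      using M(1) smll_structure_iff by blast
    then have conc: "\<Gamma>' = conclusions M'"
      unfolding M' G' M(2) by (simp add: conclusions_map)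
    have "edges M' - set_mset \<Gamma>' = s ` ?hid"
      unfolding M' G' by (simp add: image_set_diff[OF s(1)])
    also have "\<dots> = ?hid"
      using hid by (auto simp: s_def image_iff)
    finally have "(edges M' - set_mset \<Gamma>') \<inter> insert e' (edges (?N' - {#BotBox e' \<Gamma>' M'#})) =
        ?hid \<inter> ren ` insert e (edges R)"
      unfolding b(5) by (simp add: R b(2))
    also have "\<dots> = {}"
      using M(4) hid by (auto simp: ren_def)
    finally show ?thesis
      using smll_net_rename[OF M(1,3) s] conc unfolding M' smll_net_def by blast
  qed
  moreover have "acyc ?N'"
    unfolding acyc_def
  proof (intro allI impI)
    fix H assume "net_switched ?N' H"
    then obtain G where "net_switched K G" "H = image_mset (map_prod ren ren) G"
      using net_switched_map_link[of ren, OF ren_ty] by blast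
    then show "forest H"
      using forest_identify[OF forest_ac] unfolding ren_def by blast
  qed
  moreover have "conclusions ?N' = conclusions ?N"
    using conclusions_cancel[of ?N "add_mset a C" "{#b, c#}" "all_prems K"]
      conclusions_cancel[of ?N' "add_mset a C" "{#}" "all_prems K"] new
    by (simp add: C pk add_mset_commute)
  ultimately show ?thesis
    unfolding smll_net_iff smll_structure_iff[of ?N'] by blast
qed

lemma red_net:
  assumes "smll_net N" "N \<leadsto> N'"
  shows "smll_net N' \<and> conclusions N' = conclusions N"
  using assms(2,1)
proof (cases rule: red.cases)
  case (ax_cut l a b k c K)
  then show ?thesis using ax_cut_net assms(1) by blast
next
  case (tensor_par k c f a b d e K)
  then show ?thesis using tensor_par_net assms(1) by blast
next
  case (sync_tensor a b c xs d ys K a' b')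
  then show ?thesis using sync_tensor_net assms(1) by blast
next
  case (sync_par a b c xs d ys K a' b')
  then show ?thesis using sync_par_net assms(1) by blast
next
  case (sync_ax l a b xs a' ys K b')
  then show ?thesis using sync_ax_net assms(1) by blast
next
  case (sync_cut k n' p xs n ys K p')
  then show ?thesis using sync_cut_net assms(1) by blast
next
  case (sync_one ps K)
  then show ?thesis using sync_one_net assms(1) by blast
next
  case (box_one k e a \<Gamma> M K)
  then show ?thesis using box_one_net assms(1) by blast
qed

section \<open>Normal forms\<close>

lemma finite_set_link: "finite (set_link l)"
  by (induction l) auto

lemma finite_edges: "finite (edges N)"
  by (simp add: edges_def finite_set_link)

lemma fresh_edge:
  assumes "finite E" obtains e where "e \<notin> E" "ty e = A"
proof -
  have "inj (\<lambda>i::nat. Edge i A)"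
    by (auto simp: inj_def)
  then have "infinite (range (\<lambda>i::nat. Edge i A))"
    by (simp add: finite_image_iff)
  then have "\<exists>e\<in>range (\<lambda>i. Edge i A). e \<notin> E"
    using finite_subset[OF _ assms] by blast
  then show ?thesis
    using that by auto
qed

lemma negative_not_bot_free: "negative A \<Longrightarrow> \<not> bot_free A"
  by (induction A) auto

lemma positive_bot_free: "positive A \<Longrightarrow> bot_free A"
  by (induction A) auto

lemma split_two:
  assumes "l \<in># N" "l' \<in># N" "l \<noteq> l'"
  obtains K where "N = {#l, l'#} + K"
proof -
  obtain L where L: "N = add_mset l L"
    using assms(1) by (auto dest: multi_member_split)
  then have "l' \<in># L"
    using assms by simp
  then obtain K where "L = add_mset l' K"
    by (auto dest: multi_member_split)
  then show ?thesis
    using L that by simp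
qed

lemma split_three:
  assumes "l \<in># N" "l' \<in># N" "l'' \<in># N" "l \<noteq> l'" "l \<noteq> l''" "l' \<noteq> l''"
  obtains K where "N = {#l, l', l''#} + K"
proof -
  obtain K where K: "N = {#l, l'#} + K"
    using split_two[OF assms(1,2,4)] by blast
  then have "l'' \<in># K"
    using assms by auto
  then obtain K' where "K = add_mset l'' K'"
    by (auto dest: multi_member_split)
  then show ?thesis
    using K that[of K'] by simp
qed

lemma distinct_subset_mset: "distinct xs \<Longrightarrow> set xs \<subseteq> set_mset N \<Longrightarrow> mset xs \<subseteq># N"
proof (induction xs arbitrary: N)
  case (Cons x xs)
  then obtain N' where N: "N = add_mset x N'"
    by (auto dest: multi_member_split)
  then have "set xs \<subseteq> set_mset N'"
    using Cons.prems by auto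
  then show ?case
    using Cons N by simp
qed simp

lemma distinct_if_count: "\<forall>x. count (mset xs) x \<le> 1 \<Longrightarrow> distinct xs"
proof (induction xs)
  case (Cons a xs)
  have "count (mset xs) x \<le> 1" for x
    by (rule le_trans[OF _ Cons.prems[rule_format, of x]]) simp
  moreover have "count (mset xs) a = 0"
    using Cons.prems[rule_format, of a] by simp
  ultimately show ?case
    using Cons.IH by (simp add: count_eq_zero_iff)
qed simp

text \<open>Iteration in a finite set becomes periodic; \<open>k\<close> is the least period from a
  point \<open>m\<close> on the cycle, which makes the first \<open>k\<close> iterates
  distinct.\<close>

lemma functional_cycle:
  assumes "finite U" "l \<in> U" "\<And>l. l \<in> U \<Longrightarrow> f l \<in> U"
  obtains k m where "k > 0" "\<forall>i. (f ^^ i) m \<in> U" "(f ^^ k) m = m" "inj_on (\<lambda>i. (f ^^ i) m) {..<k}"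
proof -
  have U: "(f ^^ i) l \<in> U" for i
    by (induction i) (use assms(2,3) in auto)
  have "\<not> inj (\<lambda>i::nat. (f ^^ i) l)"
  proof
    assume "inj (\<lambda>i::nat. (f ^^ i) l)"
    then have "infinite (range (\<lambda>i::nat. (f ^^ i) l))"
      by (simp add: finite_image_iff)
    moreover have "range (\<lambda>i::nat. (f ^^ i) l) \<subseteq> U"
      using U by blast
    ultimately show False
      using finite_subset[OF _ assms(1)] by blast
  qed
  then obtain i j :: nat where ij: "(f ^^ i) l = (f ^^ j) l" "i < j"
    unfolding inj_def by (metis linorder_neqE_nat)
  define m where "m = (f ^^ i) l"
  have shift: "(f ^^ n) m = (f ^^ (n + i)) l" for n
    by (simp add: m_def funpow_add)
  define P where "P = (\<lambda>k. k > 0 \<and> (f ^^ k) m = m)"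
  define k where "k = (LEAST k. P k)"
  have "P (j - i)"
    using ij by (simp add: P_def shift) (simp add: m_def)
  then have k: "P k"
    unfolding k_def by (rule LeastI)
  have least: "\<not> P n" if "n < k" for n
    using that unfolding k_def by (rule not_less_Least)
  have neq: "(f ^^ p) m \<noteq> (f ^^ q) m" if "p < q" "q < k" for p q
  proof
    assume eq: "(f ^^ p) m = (f ^^ q) m"
    \<comment> \<open>Applying \<open>f\<close> another k - q times to both sides returns to
      \<open>m\<close> after k - q + p < k steps, against minimality.\<close>
    have "(f ^^ (k - q + p)) m = (f ^^ (k - q)) ((f ^^ p) m)"
      by (simp add: funpow_add)
    also have "\<dots> = (f ^^ (k - q + q)) m"
      unfolding eq by (simp add: funpow_add)
    also have "\<dots> = m"
      using k that by (simp add: P_def)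
    finally have "P (k - q + p)"
      using that by (simp add: P_def)
    then show False
      using least that by simp
  qed
  have "inj_on (\<lambda>i. (f ^^ i) m) {..<k}"
  proof (rule inj_onI)
    fix p q assume "p \<in> {..<k}" "q \<in> {..<k}" "(f ^^ p) m = (f ^^ q) m"
    then show "p = q"
      using neq[of p q] neq[of q p] by (cases p q rule: linorder_cases) auto
  qed
  then show ?thesis
    using that[of k m] k U by (simp add: P_def shift)
qed

section \<open>The walk along blocked links in a closed normal net\<close>

locale closed_normal_net =
  fixes N :: "'v struct"
  assumes net: "smll_net N" and closed: "closed_net N" and normal: "\<nexists>N'. N \<leadsto> N'"
begin

lemma struc: "smll_structure N"
  using net unfolding smll_net_def ..

lemma lin: "linear N"
  using struc smll_structure_iff by blast

lemma wt: "l \<in># N \<Longrightarrow> well_typed l"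
  using struc smll_structure_iff by blast

lemma no_path: "\<not> cyclic_switching_path N vs es"
  using net unfolding smll_net_def correct_iff[of N] by blast

lemma fresh:
  obtains e where "e \<notin> edges N" "ty e = A"
  using fresh_edge[OF finite_edges] by blast

lemma fresh2:
  obtains e e' where "e \<notin> edges N" "ty e = A" "e' \<notin> edges N" "ty e' = B" "e \<noteq> e'"
proof -
  obtain e where e: "e \<notin> edges N" "ty e = A"
    by (rule fresh)
  obtain e' where "e' \<notin> insert e (edges N)" "ty e' = B"
    using fresh_edge[of "insert e (edges N)" B] finite_edges by blast
  then show ?thesis
    using e that by auto
qed

lemma no_ax_cut:
  assumes "l \<in># N" "k \<in># N" "l \<in> {Ax a b, Ax b a}" "k \<in> {Cut b c, Cut c b}" shows False
proof -
  have "l \<noteq> k" using assms by auto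
  then obtain K where K: "N = {#l, k#} + K"
    using split_two[OF assms(1,2)] by blast
  show False
    using red.ax_cut[OF assms(3,4), of K, folded K] normal by blast
qed

lemma no_tensor_par:
  assumes "TensorL a b c \<in># N" "ParL d e f \<in># N" "k \<in># N" "k \<in> {Cut c f, Cut f c}" shows False
proof -
  have "TensorL a b c \<noteq> k" "ParL d e f \<noteq> k" "TensorL a b c \<noteq> ParL d e f" using assms by auto
  then obtain K where K: "N = {#TensorL a b c, ParL d e f, k#} + K"
    using split_three[OF assms(1-3)] by blast
  show False
    using red.tensor_par[OF assms(4), of a b d e K, folded K] normal by blast
qed

lemma no_sync_tensor:
  assumes "TensorL a b c \<in># N" "Sync ps \<in># N" "(c, d) \<in> set ps" shows False
proof -
  obtain xs ys where ps: "ps = xs @ (c, d) # ys"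
    using split_list[OF assms(3)] by blast
  have "TensorL a b c \<noteq> Sync ps" by simp
  then obtain K where K: "N = {#TensorL a b c, Sync (xs @ (c, d) # ys)#} + K"
    using split_two[OF assms(1,2)] unfolding ps by blast
  obtain a' b' where "a' \<notin> edges N" "ty a' = ty a" "b' \<notin> edges N" "ty b' = ty b" "a' \<noteq> b'"
    by (rule fresh2)
  from red.sync_tensor[OF K this(1,3,5,2,4)] show False
    using normal by blast
qed

lemma no_sync_ax:
  assumes "l \<in># N" "l \<in> {Ax a b, Ax b a}" "Sync ps \<in># N" "(a, a') \<in> set ps" "positive (ty a)"
  shows False
proof -
  obtain xs ys where ps: "ps = xs @ (a, a') # ys"
    using split_list[OF assms(4)] by blast
  have "l \<noteq> Sync ps" using assms(2) by auto
  then obtain K where K: "N = {#l, Sync (xs @ (a, a') # ys)#} + K"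
    using split_two[OF assms(1,3)] unfolding ps by blast
  obtain b' where "b' \<notin> edges N" "ty b' = ty b"
    by (rule fresh)
  from red.sync_ax[OF assms(2,5) K this] show False
    using normal by blast
qed

lemma no_sync_cut:
  assumes "k \<in># N" "k \<in> {Cut n' p, Cut p n'}" "Sync ps \<in># N" "(n, n') \<in> set ps" "negative (ty n')"
  shows False
proof -
  obtain xs ys where ps: "ps = xs @ (n, n') # ys"
    using split_list[OF assms(4)] by blast
  have "k \<noteq> Sync ps" using assms(2) by auto
  then obtain K where K: "N = {#k, Sync (xs @ (n, n') # ys)#} + K"
    using split_two[OF assms(1,3)] unfolding ps by blast
  obtain p' where "p' \<notin> edges N" "ty p' = ty p"
    by (rule fresh)
  from red.sync_cut[OF assms(2,5) K this] show False
    using normal by blast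
qed

lemma no_sync_one:
  assumes "Sync ps \<in># N" "\<forall>p\<in>fst ` set ps. OneL p \<in># N" shows False
proof -
  obtain K where K: "N = add_mset (Sync ps) K"
    using assms(1) by (auto dest: multi_member_split)
  \<comment> \<open>Distinct premisses come from distinct one links, so these are contained in
    \<open>K\<close> as a multiset, as the rule requires.\<close>
  have "count (mset (map fst ps)) x \<le> 1" for x
    using count_prems[OF lin assms(1)] by simp
  then have "distinct (map fst ps)"
    by (intro distinct_if_count) blast
  then have "distinct (map (OneL \<circ> fst) ps)"
    by (auto simp: distinct_map inj_on_def)
  moreover have "set (map (OneL \<circ> fst) ps) \<subseteq> set_mset K"
    using assms(2) K by auto
  ultimately have "mset (map (OneL \<circ> fst) ps) \<subseteq># K"
    by (rule distinct_subset_mset)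
  then obtain K' where "K = mset (map (OneL \<circ> fst) ps) + K'"
    by (auto simp: mset_subset_eq_exists_conv)
  then have "N = {#Sync ps#} + mset (map (OneL \<circ> fst) ps) + K'"
    by (simp add: K)
  from red.sync_one[of ps K', folded this] show False
    using normal by blast
qed

lemma no_box_one:
  assumes "BotBox e \<Gamma> M \<in># N" "OneL a \<in># N" "k \<in># N" "k \<in> {Cut e a, Cut a e}" shows False
proof -
  have "BotBox e \<Gamma> M \<noteq> k" "OneL a \<noteq> k" "BotBox e \<Gamma> M \<noteq> OneL a" using assms by auto
  then obtain K where K: "N = {#BotBox e \<Gamma> M, OneL a, k#} + K"
    using split_three[OF assms(1-3)] by blast
  show False
    using red.box_one[OF assms(4), of \<Gamma> M K, folded K] normal by blast
qed

text \<open>A walk going up along \<open>f\<close> reaches \<open>v\<close> where \<open>v\<close>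
  may be entered: through the border of a box or through an out-edge of a sync link. The lock is
  left out, being the exit of its box.\<close>

definition arrives :: "'v edge \<Rightarrow> 'v edge link \<Rightarrow> bool" where
  "arrives f v \<longleftrightarrow> v \<in># N \<and> ((\<exists>e \<Gamma> M. v = BotBox e \<Gamma> M \<and> f \<in># \<Gamma>) \<or>
    (\<exists>ps. v = Sync ps \<and> f \<in> snd ` set ps \<and> positive (ty f)))"

lemma arrives_concl: "arrives f v \<Longrightarrow> v \<in># N \<and> f \<in># concls v"
  by (force simp: arrives_def)

lemma arrives_unique: "l \<in># N \<Longrightarrow> c \<in># concls l \<Longrightarrow> arrives c v \<Longrightarrow> v = l"
  using concls_unique[OF lin] arrives_concl by blast

lemma produced: "l \<in># N \<Longrightarrow> e \<in># prems l \<Longrightarrow> \<exists>l'\<in>#N. e \<in># concls l'"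
  using lin unfolding linear_def by (meson all_concls_obtain mem_all_prems mset_subset_eqD)

lemma not_arrives:
  assumes "l \<in># N" "c \<in># concls l" "\<not> is_BotBox l" "\<not> is_Sync l"
  shows "\<not> arrives c v"
proof
  assume "arrives c v"
  moreover from this have "v = l"
    using arrives_unique assms(1,2) by blast
  ultimately show False
    using assms(3,4) unfolding arrives_def by auto
qed

lemma not_arrives_lock: "BotBox e \<Gamma> M \<in># N \<Longrightarrow> e \<notin># \<Gamma> \<and> \<not> arrives e v"
proof -
  assume B: "BotBox e \<Gamma> M \<in># N"
  then have "e \<notin># \<Gamma>"
    using count_concls[OF lin B, of e] by (simp add: not_in_iff)
  moreover have False if "arrives e v"
  proof -
    have "v = BotBox e \<Gamma> M"
      using arrives_unique[OF B _ that] by simp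
    then show False
      using that \<open>e \<notin># \<Gamma>\<close> unfolding arrives_def by auto
  qed
  ultimately show ?thesis
    by blast
qed

lemma not_arrives_sync: "Sync ps \<in># N \<Longrightarrow> (p, c) \<in> set ps \<Longrightarrow> negative (ty c) \<Longrightarrow> \<not> arrives c v"
proof
  assume s: "Sync ps \<in># N" "(p, c) \<in> set ps" "negative (ty c)" and v: "arrives c v"
  moreover have "c \<in># concls (Sync ps)"
    using s(2) by force
  ultimately have "v = Sync ps"
    using concls_unique[OF lin, of v "Sync ps" c] arrives_concl by blast
  then show False
    using v s positive_not_negative by (auto simp: arrives_def)
qed

text \<open>The other producers make a redex: an axiom the axiom/cut one, and a negative sync
  conclusion the one that moves the sync link across the cut.\<close>

lemma cut_premise:
  assumes k: "k \<in># N" "k \<in> {Cut a b, Cut b a}" and "\<nexists>v. arrives a v"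
  shows "(\<exists>p q. TensorL p q a \<in># N) \<or> (\<exists>p q. ParL p q a \<in># N) \<or> OneL a \<in># N \<or> (\<exists>\<Gamma> M. BotBox a \<Gamma> M \<in># N)"
proof -
  obtain l where l: "l \<in># N" "a \<in># concls l"
    using produced[OF k(1), of a] k(2) by auto
  show ?thesis
  proof (cases l)
    case (Ax x y)
    then have "l \<in> {Ax (if a = x then y else x) a, Ax a (if a = x then y else x)}"
      using l(2) by auto
    then show ?thesis
      using no_ax_cut[OF l(1) k(1), of _ a b] k(2) by blast
  next
    case (BotBox e \<Gamma> M)
    then have "a \<notin># \<Gamma>"
      using assms(3) l(1) unfolding arrives_def by blast
    then show ?thesis
      using l BotBox by auto
  next
    case (Sync ps)
    then obtain n where n: "(n, a) \<in> set ps"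
      using l(2) by auto
    have "\<not> positive (ty a)"
      using assms(3) l Sync n unfolding arrives_def by force
    then have "negative (ty a)"
      using wt[OF l(1)] Sync n by auto
    then show ?thesis
      using no_sync_cut[OF k(1) _ _ n] k(2) l(1) Sync by blast
  qed (use l in auto)
qed

text \<open>Otherwise \<open>cut_premise\<close> leaves tensor, par, one and lock on either side.
  Dual types pair tensor with par and one with lock, and each pairing is a redex.\<close>

lemma cut_arrives:
  assumes k: "k \<in># N" "k \<in> {Cut a b, Cut b a}"
  shows "(\<exists>v. arrives a v) \<or> (\<exists>v. arrives b v)"
proof (rule ccontr)
  assume "\<not> ?thesis"
  then have a: "(\<exists>p q. TensorL p q a \<in># N) \<or> (\<exists>p q. ParL p q a \<in># N) \<or> OneL a \<in># N \<or> (\<exists>\<Gamma> M. BotBox a \<Gamma> M \<in># N)"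
    and b: "(\<exists>p q. TensorL p q b \<in># N) \<or> (\<exists>p q. ParL p q b \<in># N) \<or> OneL b \<in># N \<or> (\<exists>\<Gamma> M. BotBox b \<Gamma> M \<in># N)"
    using cut_premise[OF k] cut_premise[of k b a] k by blast+
  have ty: "ty b = neg (ty a)"
    using wt[OF k(1)] k(2) by auto
  have k': "k \<in> {Cut b a, Cut a b}"
    using k(2) by auto
  from a show False
  proof (elim disjE exE)
    fix p q assume "TensorL p q a \<in># N"
    moreover from this have "ParL d e b \<notin># N" for d e
      using no_tensor_par[OF _ _ k] by blast
    ultimately show False
      using b ty by (auto dest!: wt)
  next
    fix p q assume "ParL p q a \<in># N"
    moreover from this have "TensorL d e b \<notin># N" for d e
      using no_tensor_par[OF _ _ k(1) k'] by blast
    ultimately show False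
      using b ty by (auto dest!: wt)
  next
    assume "OneL a \<in># N"
    moreover from this have "BotBox b \<Gamma> M \<notin># N" for \<Gamma> M
      using no_box_one[OF _ _ k(1) k'] by blast
    ultimately show False
      using b ty by (auto dest!: wt)
  next
    fix \<Gamma> M assume "BotBox a \<Gamma> M \<in># N"
    moreover from this have "OneL b \<notin># N"
      using no_box_one[OF _ _ k] by blast
    ultimately show False
      using b ty by (auto dest!: wt)
  qed
qed

text \<open>\<open>exits\<close> and \<open>entry\<close> fix the direction in which the walk
  crosses a link. All premisses of a par link and all out-edges of a sync link are entries, so a
  walk that enters each link once uses at most one of them.\<close>

primrec exits :: "'v edge link \<Rightarrow> 'v edge \<Rightarrow> bool" where
  "exits (Ax a b) x \<longleftrightarrow> False"
| "exits (Cut a b) x \<longleftrightarrow> x \<in> {a, b} \<and> (\<exists>v. arrives x v)"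
| "exits (TensorL a b c) x \<longleftrightarrow> x = c"
| "exits (ParL a b c) x \<longleftrightarrow> x = c"
| "exits (OneL a) x \<longleftrightarrow> False"
| "exits (BotBox e \<Gamma> M) x \<longleftrightarrow> x = e"
| "exits (Sync ps) x \<longleftrightarrow> x \<notin> out_edges ps"

primrec entry :: "'v edge link \<Rightarrow> 'v edge \<Rightarrow> bool" where
  "entry (Ax a b) x \<longleftrightarrow> False"
| "entry (Cut a b) x \<longleftrightarrow> x \<in> {a, b} \<and> (\<nexists>v. arrives x v)"
| "entry (TensorL a b c) x \<longleftrightarrow> x \<in> {a, b}"
| "entry (ParL a b c) x \<longleftrightarrow> x \<in> {a, b}"
| "entry (OneL a) x \<longleftrightarrow> False"
| "entry (BotBox e \<Gamma> M) x \<longleftrightarrow> x \<in># \<Gamma>"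
| "entry (Sync ps) x \<longleftrightarrow> x \<in> out_edges ps"

lemma exits_entry: "l \<in># N \<Longrightarrow> exits l x \<Longrightarrow> \<not> entry l x"
  using wt[of l] not_arrives_lock by (cases l) auto

text \<open>A normal form may contain tensor and par links; those with \<bottom> in the conclusion
  are included as way stations, so that a descent consists of single steps inside the set.\<close>

definition stuck :: "'v edge link set" where
  "stuck = {l. l \<in># N \<and> (is_BotBox l \<or> is_Sync l \<or> is_Cut l \<or>
    (is_TensorL l \<or> is_ParL l) \<and> (\<exists>c\<in>#concls l. \<not> bot_free (ty c)))}"

lemma arrives_stuck: "arrives x v \<Longrightarrow> v \<in> stuck \<and> entry v x"
  by (force simp: arrives_def stuck_def out_edges_def)

text \<open>Closedness provides a consumer of \<open>x\<close>. A tensor or par link passes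
  \<bottom> on to its conclusion, and a sync link has \<open>x\<close> as a negative premiss, hence
  as an out-edge, since positive formulas contain no \<bottom>.\<close>

lemma descend:
  assumes l: "l \<in># N" "x \<in># concls l" "\<not> bot_free (ty x)" "\<nexists>v. arrives x v"
  shows "\<exists>l'\<in>stuck. entry l' x \<and> x \<in># prems l'"
proof -
  have "x \<notin># conclusions N"
    using closed l(3) unfolding closed_net_def by blast
  then have "count (all_concls N) x \<le> count (all_prems N) x"
    unfolding conclusions_def in_diff_count by simp
  moreover have "count (all_concls N) x > 0"
    using mem_all_concls[OF l(1,2)] by simp
  ultimately have "count (all_prems N) x > 0"
    by linarith
  then have "x \<in># all_prems N"
    by (simp only: count_greater_zero_iff)
  then obtain l' where l': "l' \<in># N" "x \<in># prems l'"
    by (rule all_prems_obtain)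
  have "entry l' x \<and> l' \<in> stuck"
  proof (cases l')
    case (Sync ps)
    then obtain c where "(x, c) \<in> set ps"
      using l'(2) by auto
    moreover from this have "positive (ty x) \<or> negative (ty x)"
      using wt[OF l'(1)] Sync by auto
    then have "negative (ty x)"
      using l(3) positive_bot_free by blast
    ultimately show ?thesis
      using l' Sync by (force simp: out_edges_def stuck_def)
  qed (use l' l(3,4) wt[OF l'(1)] in \<open>auto simp: stuck_def\<close>)
  then show ?thesis
    using l'(2) by blast
qed

text \<open>An axiom or a tensor link above \<open>p\<close> makes a redex, par links and locks have
  conclusions of the wrong type, and one links are excluded.\<close>

lemma sync_premise:
  assumes "Sync ps \<in># N" "(p, c) \<in> set ps" "positive (ty p)" "OneL p \<notin># N"
  shows "\<exists>v. arrives p v"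
proof -
  have "p \<in># prems (Sync ps)"
    using assms(2) by force
  then obtain l where l: "l \<in># N" "p \<in># concls l"
    using produced assms(1) by blast
  show ?thesis
  proof (cases l)
    case (Ax x y)
    then have "l \<in> {Ax p (if p = x then y else x), Ax (if p = x then y else x) p}"
      using l(2) by auto
    then show ?thesis
      using no_sync_ax[OF l(1) _ assms(1,2,3)] by blast
  next
    case (TensorL a b d)
    then show ?thesis
      using no_sync_tensor[of a b p ps c] assms l TensorL by auto
  next
    case (BotBox e \<Gamma> M)
    then have "p \<noteq> e"
      using wt[OF l(1)] assms(3) by auto
    then have "p \<in># \<Gamma>"
      using l(2) BotBox by simp
    then show ?thesis
      using l(1) BotBox unfolding arrives_def by blast
  next
    case (Sync qs)
    then have "p \<in> snd ` set qs"
      using l(2) by simp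
    then show ?thesis
      using l(1) Sync assms(3) unfolding arrives_def by blast
  qed (use l assms wt[OF l(1)] in auto)
qed

text \<open>Otherwise the sync link would carry a loop, a switching cycle of length one.\<close>

lemma out_edges_disjoint: "Sync ps \<in># N \<Longrightarrow> z \<in> set ps \<Longrightarrow> in_edge z \<notin> out_edges ps"
  using in_out_edge_loop[of ps "in_edge z"] out_edges_eq[of ps] wt[of "Sync ps"]
    loop_path[OF lin, of "Sync ps" "in_edge z"] no_path by blast

lemma stuck_step:
  assumes "l \<in> stuck"
  shows "\<exists>x l'. l' \<in> stuck \<and> exits l x \<and> entry l' x \<and> joins l x l'"
proof -
  have lN: "l \<in># N"
    using assms by (simp add: stuck_def)
  have down: ?thesis if "x \<in># concls l" "\<not> bot_free (ty x)" "\<nexists>v. arrives x v" "exits l x" for x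
    using descend[OF lN that(1,2,3)] that(1,4) by (auto simp: joins_def)
  have jump: ?thesis if "x \<in># prems l" "arrives x v" "exits l x" for x v
    using arrives_stuck[OF that(2)] arrives_concl[OF that(2)] that(1,3) by (auto simp: joins_def)
  show ?thesis
  proof (cases l)
    case (Cut a b)
    then obtain x v where "x \<in> {a, b}" "arrives x v"
      using cut_arrives[OF lN, of a b] by auto
    then show ?thesis
      using jump[of x v] Cut by auto
  next
    case (TensorL a b c)
    then show ?thesis
      using assms not_arrives[OF lN] by (intro down[of c]) (auto simp: stuck_def)
  next
    case (ParL a b c)
    then show ?thesis
      using assms not_arrives[OF lN] by (intro down[of c]) (auto simp: stuck_def)
  next
    case (BotBox e \<Gamma> M)
    then show ?thesis
      using not_arrives_lock[of e \<Gamma> M] lN wt[OF lN] by (intro down[of e]) auto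
  next
    case (Sync ps)
    show ?thesis
    \<comment> \<open>A negative conclusion is an in-edge whose type contains \<bottom>, so the walk
      goes down. If all types are positive, some premiss does not come from a one link, as the sync
      link cannot be erased, and the walk goes up.\<close>
    proof (cases "\<exists>(p, c)\<in>set ps. negative (ty c)")
      case True
      then obtain p c where pc: "(p, c) \<in> set ps" "negative (ty c)"
        by blast
      then have "ty p = ty c"
        using wt[OF lN] Sync by auto
      then have "in_edge (p, c) = c"
        using pc(2) positive_not_negative by (auto simp: in_edge_def)
      then have "c \<notin> out_edges ps"
        using out_edges_disjoint[of ps "(p, c)"] pc lN Sync by auto
      moreover have "c \<in># concls l"
        using pc Sync by force
      ultimately show ?thesis
        using not_arrives_sync[OF _ pc] lN Sync negative_not_bot_free[OF pc(2)] by (intro down[of c]) auto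
    next
      case False
      then have pos: "positive (ty p)" if "(p, c) \<in> set ps" for p c
        using that False wt[OF lN] Sync by fastforce
      obtain p where "p \<in> fst ` set ps" "OneL p \<notin># N"
        using no_sync_one[of ps] lN Sync by blast
      then obtain c where pc: "(p, c) \<in> set ps" "OneL p \<notin># N"
        by auto
      then have "in_edge (p, c) = p"
        using pos by (simp add: in_edge_def)
      then have "p \<notin> out_edges ps"
        using out_edges_disjoint[of ps "(p, c)"] pc lN Sync by auto
      moreover obtain v where "arrives p v"
        using sync_premise[of ps p c] pc pos lN Sync by blast
      moreover have "p \<in># prems l"
        using pc Sync by force
      ultimately show ?thesis
        using jump[of p v] Sync by simp
    qed
  qed (use assms in \<open>auto simp: stuck_def\<close>)
qed

text \<open>With the least period every link is entered once. A pair of edges forbidden by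
  \<open>switching\<close> would consist of two entries of the same link.\<close>

lemma stuck_empty: "stuck = {}"
proof (rule ccontr)
  assume "stuck \<noteq> {}"
  then obtain l0 where l0: "l0 \<in> stuck"
    by blast
  obtain X nxt where step: "\<And>l. l \<in> stuck \<Longrightarrow>
      nxt l \<in> stuck \<and> exits l (X l) \<and> entry (nxt l) (X l) \<and> joins l (X l) (nxt l)"
    using stuck_step by metis
  have fin: "finite stuck"
    by (rule finite_subset[of _ "set_mset N"]) (auto simp: stuck_def)
  have nxt: "nxt l \<in> stuck" if "l \<in> stuck" for l
    using step[OF that] by blast
  obtain k m where k: "k > 0" "\<forall>i. (nxt ^^ i) m \<in> stuck" "(nxt ^^ k) m = m"
    "inj_on (\<lambda>i. (nxt ^^ i) m) {..<k}"
    by (rule functional_cycle[of stuck l0 nxt, OF fin l0 nxt])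
  define v where "v = (\<lambda>i. (nxt ^^ i) m)"
  define x where "x = (\<lambda>i. X (v i))"
  have vN: "v i \<in># N" for i
    using k(2) by (simp add: v_def stuck_def)
  have vx: "exits (v i) (x i)" "entry (v (Suc i)) (x i)" "joins (v i) (x i) (v (Suc i))" for i
    using step[OF k(2)[rule_format, of i]] by (simp_all add: v_def x_def)
  have xe: "x i \<in># ends (v i)" "x i \<in># ends (v (Suc i))" for i
    using vx(3)[of i] by (auto simp: joins_def)
  have v_neq: "v i \<noteq> v (Suc i)" for i
    using vx(1,2)[of i] exits_entry[OF vN] by metis
  have v_inj: "v i = v j \<Longrightarrow> i < k \<Longrightarrow> j < k \<Longrightarrow> i = j" for i j
    using inj_onD[OF k(4), of i j] by (simp add: v_def)
  have vk: "v k = v 0"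
    using k(3) by (simp add: v_def)
  \<comment> \<open>The entered nodes are v 1, ..., v k, so the last index has to be wrapped around
    by v k = v 0.\<close>
  have v_Suc_inj: "i = j" if "v (Suc i) = v (Suc j)" "i < k" "j < k" for i j
  proof (cases "Suc i = k \<or> Suc j = k")
    case True
    then show ?thesis
      using that vk v_inj[of 0 "Suc j"] v_inj[of 0 "Suc i"] by (auto elim!: less_SucE)
  next
    case False
    then show ?thesis
      using that v_inj[of "Suc i" "Suc j"] by auto
  qed
  \<comment> \<open>Only \<open>v i\<close> and \<open>v (Suc i)\<close> touch \<open>x i\<close>,
    and \<open>v i\<close> has it as an exit. This is applied to premisses of par links and to
    out-edges of sync links.\<close>
  have enters: "l = v (Suc i)" if "l \<in># N" "x i \<in># ends l" "\<not> exits l (x i)" for l i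
    using shared_edge(2)[OF lin vN vN v_neq xe that(1,2)] vx(1)[of i] that(3) by blast
  have x_inj: "i = j" if "x i = x j" "i < k" "j < k" for i j
  proof -
    have "\<not> exits (v (Suc j)) (x j)"
      using exits_entry[OF vN] vx(2) by blast
    then have "v (Suc j) = v (Suc i)"
      using enters[of "v (Suc j)" i] vN xe(2)[of j] that(1) by simp
    then show ?thesis
      using v_Suc_inj that by blast
  qed
  let ?vs = "map v [0..<Suc k]" and ?es = "map x [0..<k]"
  have "\<not> (a \<in> set ?es \<and> b \<in> set ?es)" if P: "ParL a b c \<in># N" for a b c
  proof
    assume "a \<in> set ?es \<and> b \<in> set ?es"
    then obtain i j where ij: "a = x i" "i < k" "b = x j" "j < k"
      by auto
    have "a \<noteq> c" "b \<noteq> c"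
      using wt[OF P] by auto
    then have "ParL a b c = v (Suc i)"
      by (intro enters[OF P]) (auto simp flip: ij(1))
    moreover have "ParL a b c = v (Suc j)"
      using \<open>b \<noteq> c\<close> by (intro enters[OF P]) (auto simp flip: ij(3))
    ultimately have "a = b"
      using v_Suc_inj[of i j] ij by simp
    then show False
      using count_prems[OF lin P, of a] by simp
  qed
  moreover have "card (out_edges ps \<inter> set ?es) \<le> 1" if S: "Sync ps \<in># N" for ps
  proof -
    have "Sync ps = v (Suc i)" if "x i \<in> out_edges ps" for i
    proof (rule enters[OF S])
      show "x i \<in># ends (Sync ps)"
        using that by (auto simp: out_edges_def)
    qed (use that in simp)
    then have "x i = x j" if "x i \<in> out_edges ps" "x j \<in> out_edges ps" "i < k" "j < k" for i j
      using that v_Suc_inj[of i j] by metis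
    then have "\<forall>e\<in>out_edges ps \<inter> set ?es. \<forall>e'\<in>out_edges ps \<inter> set ?es. e = e'"
      by auto
    then show ?thesis
      by (subst One_nat_def, subst card_le_Suc0_iff_eq) auto
  qed
  ultimately have "switching N (set ?es)"
    unfolding switching_def by blast
  moreover have "distinct (tl ?vs)"
  proof -
    have "tl ?vs = map (\<lambda>i. v (Suc i)) [0..<k]"
      by (simp add: map_Suc_upt[symmetric] upt_conv_Cons comp_def del: upt_Suc)
    then show ?thesis
      using v_Suc_inj by (auto simp: distinct_map inj_on_def)
  qed
  moreover have "distinct ?es"
    using x_inj by (auto simp: distinct_map inj_on_def)
  moreover have "joins (?vs ! i) (?es ! i) (?vs ! Suc i)" if "i < length ?es" for i
  proof -
    have "?vs ! i = v i" "?vs ! Suc i = v (Suc i)" "?es ! i = x i"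
      using that by (simp_all del: upt_Suc)
    then show ?thesis
      using vx(3) by simp
  qed
  moreover have "hd ?vs = last ?vs"
    using vk by (simp add: hd_map last_map del: upt_Suc)
  moreover have "set ?vs \<subseteq> set_mset N"
    using vN by auto
  ultimately have "cyclic_switching_path N ?vs ?es"
    unfolding cyclic_switching_path_def using k(1) by (simp del: upt_Suc)
  then show False
    using no_path by blast
qed

end

lemma reds_net:
  assumes "red\<^sup>*\<^sup>* R N" "smll_net R"
  shows "smll_net N \<and> conclusions N = conclusions R"
  using assms(1)
proof (induction rule: rtranclp_induct)
  case (step M N)
  then show ?case using red_net by metis
qed (use assms(2) in simp)

theorem mainTheorem8:
  fixes R N :: "'v struct"
  assumes "smll_net R" and "closed_net R" and "normal_form_of R N"
  shows "(\<forall>l \<in># N. \<not> is_Cut l \<and> \<not> is_BotBox l \<and> \<not> is_Sync l) \<and> mll_net N"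
proof -
  have N: "smll_net N" "conclusions N = conclusions R" "\<nexists>N'. N \<leadsto> N'"
    using reds_net assms unfolding normal_form_of_def by blast+
  then interpret closed_normal_net N
    using assms(2) by unfold_locales (simp_all add: closed_net_def)
  have plain: "\<forall>l \<in># N. \<not> is_Cut l \<and> \<not> is_BotBox l \<and> \<not> is_Sync l"
    using stuck_empty unfolding stuck_def by blast
  then have "is_Ax l \<or> is_Cut l \<or> is_TensorL l \<or> is_ParL l \<or> is_OneL l" if "l \<in># N" for l
    using that by (cases l) auto
  then show ?thesis
    using plain N(1) unfolding mll_net_def by blast
qed

end
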